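(* Let $\{\alpha_n\}_{n\ge 0}$ be a sequence of points in $\mathbb{D}$ and let $\{l_n\}_{n\ge 0}$ be a sequence of positive integers such that $\sum_{n=0}^\infty l_n(1-|\alpha_n|)<\infty$. For $n\ge 0$ let $\varphi_n:=\prod_{i=n}^{\infty}b_{\alpha_i}^{l_i}$, and let $$\mathcal{S}_{\Phi}=\bigvee_{n=0}^\infty \big(z^nH^2(\mathbb{D})\otimes \varphi_n H^2(\mathbb{D})\big)\subseteq H^2(\mathbb{D}^2)$$ be the associated Rudin submodule. Then $$\dim\big(\mathcal{S}_{\Phi}\ominus (z_1\mathcal{S}_{\Phi}+z_2\mathcal{S}_{\Phi})\big)=1+\#\{n\ge 0:\alpha_n=0\}<\infty.$$
   Context: $\mathbb{D}=\{z\in\mathbb{C}:|z|<1\}$. $H^2(\mathbb{D})$ is the Hardy space over $\mathbb{D}$, and $H^2(\mathbb{D}^2)=H^2(\mathbb{D})\otimes H^2(\mathbb{D})$ (Hilbert space tensor product) is the Hardy space over the bidisc, where $f\otimes g$ is identified with the function $f(z_1)g(z_2)$. For nonzero $\alpha\in\mathbb{D}$, $b_\alpha(z)=\frac{-\bar\alpha}{|\alpha|}\frac{z-\alpha}{1-\bar\alpha z}$, and $b_0(z)=z$. The symbol $\bigvee$ denotes closed linear span. For a closed subspace $\mathcal{S}\subseteq H^2(\mathbb{D}^2)$ invariant under multiplication by $z_1$ and $z_2$, $\mathcal{S}\ominus(z_1\mathcal{S}+z_2\mathcal{S})$ denotes the set of vectors in $\mathcal{S}$ orthogonal to $z_1\mathcal{S}+z_2\mathcal{S}$;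 equivalently it is $(\mathcal{S}\ominus z_1\mathcal{S})\cap(\mathcal{S}\ominus z_2\mathcal{S})$. *)

theory Defs
  imports "HOL-Complex_Analysis.Complex_Analysis"
begin

abbreviation unit_disc :: "complex set"
  where "unit_disc \<equiv> ball 0 1"

definition square_summable :: "('i \<Rightarrow> complex) \<Rightarrow> bool"
  where "square_summable a \<longleftrightarrow> (\<lambda>i. (cmod (a i))\<^sup>2) summable_on UNIV"

(* Elements of the Hardy space of the disc are used only through their values on the disc,
   so the values of such a function off the disc are left unconstrained. *)
definition hardy_disc :: "(complex \<Rightarrow> complex) set"
  where "hardy_disc = {f. \<exists>a::nat \<Rightarrow> complex. square_summable a \<and>
           (\<forall>z\<in>unit_disc. (\<lambda>n. a n * z ^ n) sums f z)}"

definition bidisc_series :: "(nat \<times> nat \<Rightarrow> complex) \<Rightarrow> complex \<times> complex \<Rightarrow> complex"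
  where "bidisc_series a = (\<lambda>(z, w). if z \<in> unit_disc \<and> w \<in> unit_disc
           then \<Sum>\<^sub>\<infinity>(m, n)\<in>UNIV. a (m, n) * z ^ m * w ^ n else 0)"

lemma square_summable_add:
  assumes "square_summable a" "square_summable b"
  shows "square_summable (\<lambda>i. a i + b i)"
  unfolding square_summable_def
proof (rule summable_on_comparison_test)
  show "(\<lambda>i. 2 * (cmod (a i))\<^sup>2 + 2 * (cmod (b i))\<^sup>2) summable_on UNIV"
    using assms unfolding square_summable_def
    by (intro summable_on_add summable_on_cmult_right)
  fix i
  have "(cmod (a i + b i))\<^sup>2 \<le> (cmod (a i) + cmod (b i))\<^sup>2"
    by (intro power_mono norm_triangle_ineq) auto
  also have "\<dots> \<le> 2 * (cmod (a i))\<^sup>2 + 2 * (cmod (b i))\<^sup>2"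
    using sum_squares_ge_zero[of "cmod (a i) - cmod (b i)" 0]
    by (simp add: power2_eq_square algebra_simps)
  finally show "(cmod (a i + b i))\<^sup>2 \<le> 2 * (cmod (a i))\<^sup>2 + 2 * (cmod (b i))\<^sup>2" .
qed auto

lemma square_summable_scale:
  assumes "square_summable a"
  shows "square_summable (\<lambda>i. c * a i)"
  using summable_on_cmult_right[of "\<lambda>i. (cmod (a i))\<^sup>2" UNIV "(cmod c)\<^sup>2"] assms
  by (simp add: square_summable_def norm_mult power_mult_distrib)

lemma square_summable_zero: "square_summable (\<lambda>_. 0)"
  by (simp add: square_summable_def)

lemma square_summable_mult:
  assumes "square_summable a" "square_summable b"
  shows "(\<lambda>i. cmod (a i * b i)) summable_on UNIV"
  using assms unfolding square_summable_def
  by - (rule abs_summable_product; simp add: norm_mult power2_eq_square)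

lemma square_summable_reindex:
  assumes "square_summable a" "inj h" "\<And>j. j \<notin> range h \<Longrightarrow> b j = 0" "\<And>i. b (h i) = a i"
  shows "square_summable b"
proof -
  have "(\<lambda>j. (cmod (b j))\<^sup>2) summable_on range h"
    using assms by (subst summable_on_reindex) (auto simp: square_summable_def o_def)
  then show ?thesis
    unfolding square_summable_def
    using summable_on_cong_neutral[of UNIV "range h" "\<lambda>j. (cmod (b j))\<^sup>2" "\<lambda>j. (cmod (b j))\<^sup>2"] assms(3)
    by auto
qed

lemma square_summable_tensor:
  assumes "square_summable a" "square_summable b"
  shows "square_summable (\<lambda>(m, n). a m * b n)"
proof -
  have "(\<lambda>p. (cmod (a (fst p)))\<^sup>2 * (cmod (b (snd p)))\<^sup>2) summable_on UNIV \<times> UNIV"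
    using assms unfolding square_summable_def
    by (intro summable_on_SigmaI[where g = "\<lambda>m. (cmod (a m))\<^sup>2 * (\<Sum>\<^sub>\<infinity>n. (cmod (b n))\<^sup>2)"])
       (auto intro!: has_sum_cmult_right summable_on_cmult_left)
  then show ?thesis
    by (simp add: square_summable_def case_prod_unfold norm_mult power_mult_distrib)
qed

lemma square_summable_powers:
  fixes z :: complex
  assumes "z \<in> unit_disc"
  shows "square_summable (\<lambda>n. z ^ n)"
  unfolding square_summable_def
proof (rule summable_nonneg_imp_summable_on)
  have "(cmod z)\<^sup>2 < 1"
    using assms by (simp add: abs_square_less_1)
  then show "summable (\<lambda>n. (cmod (z ^ n))\<^sup>2)"
    using summable_geometric[of "(cmod z)\<^sup>2"]
    by (simp add: norm_power flip: power_mult) (simp add: mult.commute)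
qed auto

lemma square_summable_monomials:
  assumes "z \<in> unit_disc" "w \<in> unit_disc"
  shows "square_summable (\<lambda>(m, n). z ^ m * w ^ n)"
  by (intro square_summable_tensor square_summable_powers assms)

lemma has_sum_bidisc_series:
  assumes "square_summable a" "z \<in> unit_disc" "w \<in> unit_disc"
  shows "((\<lambda>(m, n). a (m, n) * z ^ m * w ^ n) has_sum bidisc_series a (z, w)) UNIV"
proof -
  have "(\<lambda>(m, n). a (m, n) * z ^ m * w ^ n) summable_on UNIV"
    using abs_summable_summable[OF square_summable_mult[OF assms(1) square_summable_monomials[OF assms(2,3)]]]
    by (simp add: case_prod_unfold mult.assoc)
  then show ?thesis
    using assms by (simp add: bidisc_series_def)
qed

lemma power_series_eq_zero:
  fixes c :: "nat \<Rightarrow> complex"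
  assumes "\<And>z. z \<in> unit_disc \<Longrightarrow> (\<lambda>n. c n * z ^ n) sums 0"
  shows "c n = 0"
proof (rule ccontr)
  assume c: "c n \<noteq> 0"
  have "c 0 = 0"
    using assms[of 0] by simp
  then have n: "n > 0"
    using c by (cases n) auto
  have 1: "(\<lambda>n. c n * (x - 0) ^ n) sums 0" if "norm (x - 0) < 1" for x :: complex
    using assms[of x] that by simp
  show False
  proof (rule powser_0_nonzero[of 1 "0::complex" c "\<lambda>_. 0" n, OF zero_less_one 1 refl c n])
    fix s :: real
    assume s: "0 < s" and nz: "\<And>z. z \<in> cball 0 s - {0::complex} \<Longrightarrow> (0::complex) \<noteq> 0"
    have "of_real s \<in> cball 0 s - {0::complex}"
      using s by simp
    from nz[OF this] show False by (rule notE) (rule refl)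
  qed
qed

lemma bidisc_series_eq_zero:
  assumes a: "square_summable a" and "bidisc_series a = (\<lambda>_. 0)"
  shows "a = (\<lambda>_. 0)"
proof -
  define c where "c w m = (\<Sum>\<^sub>\<infinity>n. a (m, n) * w ^ n)" for w m
  have zw: "((\<lambda>(m, n). a (m, n) * z ^ m * w ^ n) has_sum 0) (UNIV \<times> UNIV)"
    if "z \<in> unit_disc" "w \<in> unit_disc" for z w
    using has_sum_bidisc_series[OF a that] assms(2) by simp
  have row: "((\<lambda>n. a (m, n) * w ^ n) has_sum c w m) UNIV" if w: "w \<in> unit_disc" for w m
  proof -
    have "(\<lambda>n. a (m, n) * (1/2) ^ m * w ^ n) summable_on UNIV"
      using summable_on_SigmaD1[of "\<lambda>m n. a (m, n) * (1/2) ^ m * w ^ n" UNIV "\<lambda>_. UNIV" m]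
        has_sum_imp_summable[OF zw[of "1/2" w]] w by simp
    then have "(\<lambda>n. 2 ^ m * (a (m, n) * (1/2) ^ m * w ^ n)) summable_on UNIV"
      by (rule summable_on_cmult_right)
    then have "(\<lambda>n. a (m, n) * w ^ n) summable_on UNIV"
      by (simp add: field_simps)
    then show ?thesis by (simp add: c_def)
  qed
  have "c w m = 0" if w: "w \<in> unit_disc" for w m
  proof (rule power_series_eq_zero)
    fix z :: complex
    assume z: "z \<in> unit_disc"
    have "((\<lambda>m. c w m * z ^ m) has_sum 0) UNIV"
    proof (rule has_sum_SigmaD[OF zw[OF z w]])
      fix m
      show "((\<lambda>n. case (m, n) of (m, n) \<Rightarrow> a (m, n) * z ^ m * w ^ n) has_sum c w m * z ^ m) UNIV"
        using has_sum_cmult_left[OF row[OF w, of m], of "z ^ m"] by (simp add: mult_ac)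
    qed
    then show "(\<lambda>m. c w m * z ^ m) sums 0" by (rule has_sum_imp_sums)
  qed
  then have "a (m, n) = 0" for m n
    using row[of _ m] by (intro power_series_eq_zero[of "\<lambda>n. a (m, n)"]) (auto intro!: has_sum_imp_sums)
  then show ?thesis by auto
qed

lemma bidisc_series_add:
  assumes "square_summable a" "square_summable b"
  shows "bidisc_series (\<lambda>k. a k + b k) = (\<lambda>p. bidisc_series a p + bidisc_series b p)"
proof
  fix p :: "complex \<times> complex"
  obtain z w where p: "p = (z, w)" by force
  show "bidisc_series (\<lambda>k. a k + b k) p = bidisc_series a p + bidisc_series b p"
  proof (cases "z \<in> unit_disc \<and> w \<in> unit_disc")
    case True
    then have z: "z \<in> unit_disc" and w: "w \<in> unit_disc" by auto
    have "((\<lambda>(m, n). (a (m, n) + b (m, n)) * z ^ m * w ^ n)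
        has_sum (bidisc_series a (z, w) + bidisc_series b (z, w))) UNIV"
      using has_sum_add[OF has_sum_bidisc_series[OF assms(1) z w] has_sum_bidisc_series[OF assms(2) z w]]
      by (simp add: case_prod_unfold ring_distribs)
    from has_sum_unique[OF has_sum_bidisc_series[OF square_summable_add[OF assms] z w] this]
    show ?thesis by (simp add: p)
  qed (auto simp: p bidisc_series_def)
qed

lemma bidisc_series_scale:
  "bidisc_series (\<lambda>k. c * a k) = (\<lambda>p. c * bidisc_series a p)"
proof
  fix p :: "complex \<times> complex"
  show "bidisc_series (\<lambda>k. c * a k) p = c * bidisc_series a p"
  proof (cases p)
    case (Pair z w)
    have "(\<Sum>\<^sub>\<infinity>k\<in>UNIV. c * a k * z ^ fst k * w ^ snd k)
        = (\<Sum>\<^sub>\<infinity>k\<in>UNIV. c * (a k * z ^ fst k * w ^ snd k))"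
      by (rule infsum_cong) (simp only: mult.assoc)
    also have "\<dots> = c * (\<Sum>\<^sub>\<infinity>k\<in>UNIV. a k * z ^ fst k * w ^ snd k)"
      by (rule infsum_cmult_right')
    finally show ?thesis
      by (auto simp: Pair bidisc_series_def case_prod_unfold)
  qed
qed

lemma bidisc_series_inject:
  assumes "square_summable a" "square_summable b" "bidisc_series a = bidisc_series b"
  shows "a = b"
proof -
  have "square_summable (\<lambda>k. a k + (- 1) * b k)"
    by (intro square_summable_add square_summable_scale assms)
  moreover have "bidisc_series (\<lambda>k. a k + (- 1) * b k) = (\<lambda>_. 0)"
    unfolding bidisc_series_add[OF assms(1) square_summable_scale[OF assms(2)]]
      bidisc_series_scale assms(3) by simp
  ultimately have "(\<lambda>k. a k + (- 1) * b k) = (\<lambda>_. 0)"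
    by (rule bidisc_series_eq_zero)
  then show ?thesis by (auto simp: fun_eq_iff)
qed

(* Functions on the bidisc, extended by 0 off it so that equality of the elements of the
   type below is equality of functions on the bidisc. *)
definition bidisc_functions :: "(complex \<times> complex \<Rightarrow> complex) set"
  where "bidisc_functions = {bidisc_series a | a. square_summable a}"

typedef hardy_bidisc = bidisc_functions
  morphisms hb_fun hb_Abs
  unfolding bidisc_functions_def using square_summable_zero by (auto intro!: exI[of _ "\<lambda>_. 0"])

setup_lifting type_definition_hardy_bidisc

definition hb_coeff :: "hardy_bidisc \<Rightarrow> nat \<times> nat \<Rightarrow> complex"
  where "hb_coeff f = (THE a. square_summable a \<and> bidisc_series a = hb_fun f)"

lemma hb_coeff: "square_summable (hb_coeff f)" "bidisc_series (hb_coeff f) = hb_fun f"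
proof -
  obtain a where a: "square_summable a" "hb_fun f = bidisc_series a"
    using hb_fun[of f] by (auto simp: bidisc_functions_def)
  have "\<exists>!a. square_summable a \<and> bidisc_series a = hb_fun f"
  proof (rule ex1I)
    show "square_summable a \<and> bidisc_series a = hb_fun f"
      using a by simp
    show "b = a" if "square_summable b \<and> bidisc_series b = hb_fun f" for b
      using that a by (intro bidisc_series_inject) simp_all
  qed
  from theI'[OF this] show "square_summable (hb_coeff f)" "bidisc_series (hb_coeff f) = hb_fun f"
    by (auto simp: hb_coeff_def)
qed

lemma hb_coeffI: "square_summable a \<Longrightarrow> hb_fun f = bidisc_series a \<Longrightarrow> hb_coeff f = a"
  using hb_coeff[of f] bidisc_series_inject[of "hb_coeff f" a] by simp

lemma hb_eq_iff: "f = g \<longleftrightarrow> hb_coeff f = hb_coeff g"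
  by (metis hb_coeff(2) hb_fun_inject)

instantiation hardy_bidisc :: ab_group_add
begin

lift_definition zero_hardy_bidisc :: hardy_bidisc is "\<lambda>_. 0"
proof -
  have "bidisc_series (\<lambda>_. 0) = (\<lambda>_. 0)"
    by (auto simp: bidisc_series_def fun_eq_iff case_prod_unfold)
  then show "(\<lambda>_. 0) \<in> bidisc_functions"
    using square_summable_zero unfolding bidisc_functions_def by (metis (mono_tags, lifting) mem_Collect_eq)
qed

lift_definition plus_hardy_bidisc :: "hardy_bidisc \<Rightarrow> hardy_bidisc \<Rightarrow> hardy_bidisc"
  is "\<lambda>f g p. f p + g p"
proof -
  fix f g
  assume "f \<in> bidisc_functions" "g \<in> bidisc_functions"
  then obtain a b where "square_summable a" "f = bidisc_series a" "square_summable b" "g = bidisc_series b"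
    by (auto simp: bidisc_functions_def)
  then show "(\<lambda>p. f p + g p) \<in> bidisc_functions"
    using bidisc_series_add[of a b] square_summable_add[of a b] by (auto simp: bidisc_functions_def intro!: exI[of _ "\<lambda>k. a k + b k"])
qed

lift_definition uminus_hardy_bidisc :: "hardy_bidisc \<Rightarrow> hardy_bidisc" is "\<lambda>f p. - f p"
proof -
  fix f
  assume "f \<in> bidisc_functions"
  then obtain a where "square_summable a" "f = bidisc_series a"
    by (auto simp: bidisc_functions_def)
  then show "(\<lambda>p. - f p) \<in> bidisc_functions"
    using bidisc_series_scale[of "-1" a] square_summable_scale[of a "-1"]
    by (auto simp: bidisc_functions_def intro!: exI[of _ "\<lambda>k. - a k"])
qed

definition minus_hardy_bidisc :: "hardy_bidisc \<Rightarrow> hardy_bidisc \<Rightarrow> hardy_bidisc"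
  where "minus_hardy_bidisc f g = f + - g"

instance
  by standard (transfer; auto simp: minus_hardy_bidisc_def)+

end

lift_definition hb_scale :: "complex \<Rightarrow> hardy_bidisc \<Rightarrow> hardy_bidisc" is "\<lambda>c f p. c * f p"
proof -
  fix c f
  assume "f \<in> bidisc_functions"
  then obtain a where "square_summable a" "f = bidisc_series a"
    by (auto simp: bidisc_functions_def)
  then show "(\<lambda>p. c * f p) \<in> bidisc_functions"
    using bidisc_series_scale[of "c" a] square_summable_scale[of a "c"]
    by (auto simp: bidisc_functions_def intro!: exI[of _ "\<lambda>k. c * a k"])
qed

(* The inner product of the Hilbert space tensor product of two copies of the Hardy space
   of the disc: the functions z_1^m z_2^n, being the tensors of the orthonormal bases
   (z^m) and (z^n), are orthonormal. *)
definition hb_cinner :: "hardy_bidisc \<Rightarrow> hardy_bidisc \<Rightarrow> complex"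
  where "hb_cinner f g = (\<Sum>\<^sub>\<infinity>k. hb_coeff f k * cnj (hb_coeff g k))"

lemma hb_coeff_add: "hb_coeff (f + g) = (\<lambda>k. hb_coeff f k + hb_coeff g k)"
  by (rule hb_coeffI)
    (auto simp: square_summable_add hb_coeff bidisc_series_add plus_hardy_bidisc.rep_eq)

lemma hb_coeff_scale: "hb_coeff (hb_scale c f) = (\<lambda>k. c * hb_coeff f k)"
  by (rule hb_coeffI)
    (auto simp: square_summable_scale hb_coeff bidisc_series_scale hb_scale.rep_eq)

lemma hb_coeff_zero: "hb_coeff 0 = (\<lambda>_. 0)"
  by (rule hb_coeffI)
    (auto simp: square_summable_zero bidisc_series_def case_prod_unfold zero_hardy_bidisc.rep_eq)

lemma hb_cinner_summable: "(\<lambda>k. hb_coeff f k * cnj (hb_coeff g k)) summable_on UNIV"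
proof -
  have "square_summable (\<lambda>k. cnj (hb_coeff g k))"
    using hb_coeff(1)[of g] by (simp add: square_summable_def)
  from abs_summable_summable[OF square_summable_mult[OF hb_coeff(1) this]] show ?thesis .
qed

lemma hb_cinner_add_left: "hb_cinner (f + g) h = hb_cinner f h + hb_cinner g h"
  using infsum_add[OF hb_cinner_summable hb_cinner_summable]
  by (simp add: hb_cinner_def hb_coeff_add ring_distribs)

lemma hb_cinner_scale_left: "hb_cinner (hb_scale c f) g = c * hb_cinner f g"
  by (simp add: hb_cinner_def hb_coeff_scale mult.assoc infsum_cmult_right')

lemma hb_cinner_commute: "hb_cinner f g = cnj (hb_cinner g f)"
  by (simp add: hb_cinner_def mult.commute flip: infsum_cnj)

lemma hb_cinner_self: "hb_cinner f f = of_real (\<Sum>\<^sub>\<infinity>k. (cmod (hb_coeff f k))\<^sup>2)"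
proof -
  have "((\<lambda>k. complex_of_real ((cmod (hb_coeff f k))\<^sup>2)) has_sum
      of_real (\<Sum>\<^sub>\<infinity>k. (cmod (hb_coeff f k))\<^sup>2)) UNIV"
    using hb_coeff(1)[of f] by (intro has_sum_of_real has_sum_infsum) (simp add: square_summable_def)
  then show ?thesis
    unfolding hb_cinner_def complex_norm_square by (rule infsumI)
qed

lemma hb_cinner_self_eq_zero: "hb_cinner f f = 0 \<longleftrightarrow> f = 0"
proof
  assume "hb_cinner f f = 0"
  then have "(\<Sum>\<^sub>\<infinity>k. (cmod (hb_coeff f k))\<^sup>2) = 0"
    by (simp add: hb_cinner_self)
  then have "(cmod (hb_coeff f k))\<^sup>2 = 0" for k
    using hb_coeff(1)[of f] by (intro nonneg_infsum_le_0D[where A = UNIV]) (auto simp: square_summable_def)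
  then show "f = 0"
    by (auto simp: hb_eq_iff hb_coeff_zero)
qed (simp add: hb_cinner_def hb_coeff_zero)

instantiation hardy_bidisc :: real_inner
begin

definition scaleR_hardy_bidisc :: "real \<Rightarrow> hardy_bidisc \<Rightarrow> hardy_bidisc"
  where "scaleR_hardy_bidisc r f = hb_scale (of_real r) f"

definition inner_hardy_bidisc :: "hardy_bidisc \<Rightarrow> hardy_bidisc \<Rightarrow> real"
  where "inner_hardy_bidisc f g = Re (hb_cinner f g)"

definition norm_hardy_bidisc :: "hardy_bidisc \<Rightarrow> real"
  where "norm_hardy_bidisc f = sqrt (inner f f)"

definition dist_hardy_bidisc :: "hardy_bidisc \<Rightarrow> hardy_bidisc \<Rightarrow> real"
  where "dist_hardy_bidisc f g = norm (f - g)"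

definition sgn_hardy_bidisc :: "hardy_bidisc \<Rightarrow> hardy_bidisc"
  where "sgn_hardy_bidisc f = inverse (norm f) *\<^sub>R f"

definition uniformity_hardy_bidisc :: "(hardy_bidisc \<times> hardy_bidisc) filter"
  where "uniformity_hardy_bidisc = (INF e\<in>{0<..}. principal {(f, g). dist f g < e})"

definition open_hardy_bidisc :: "hardy_bidisc set \<Rightarrow> bool"
  where "open_hardy_bidisc U \<longleftrightarrow>
           (\<forall>f\<in>U. eventually (\<lambda>(f', g). f' = f \<longrightarrow> g \<in> U) uniformity)"

instance
proof
  fix f g h :: hardy_bidisc and r s :: real
  show "r *\<^sub>R (f + g) = r *\<^sub>R f + r *\<^sub>R g"
    unfolding scaleR_hardy_bidisc_def by transfer (simp add: ring_distribs)
  show "(r + s) *\<^sub>R f = r *\<^sub>R f + s *\<^sub>R f"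
    unfolding scaleR_hardy_bidisc_def by transfer (simp add: ring_distribs)
  show "r *\<^sub>R s *\<^sub>R f = (r * s) *\<^sub>R f"
    unfolding scaleR_hardy_bidisc_def by transfer (simp add: mult.assoc)
  show "1 *\<^sub>R f = f"
    unfolding scaleR_hardy_bidisc_def by transfer simp
  show "inner f g = inner g f"
    unfolding inner_hardy_bidisc_def by (subst hb_cinner_commute) simp
  show "inner (f + g) h = inner f h + inner g h"
    by (simp add: inner_hardy_bidisc_def hb_cinner_add_left)
  show "inner (r *\<^sub>R f) g = r * inner f g"
    by (simp add: inner_hardy_bidisc_def scaleR_hardy_bidisc_def hb_cinner_scale_left)
  show "0 \<le> inner f f"
    by (simp add: inner_hardy_bidisc_def hb_cinner_self infsum_nonneg)
  show "inner f f = 0 \<longleftrightarrow> f = 0"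
    using hb_cinner_self_eq_zero[of f] by (simp add: inner_hardy_bidisc_def hb_cinner_self)
qed (simp_all add: dist_hardy_bidisc_def norm_hardy_bidisc_def sgn_hardy_bidisc_def
      uniformity_hardy_bidisc_def open_hardy_bidisc_def)

end

interpretation hb: vector_space hb_scale
  by standard (transfer; simp add: ring_distribs mult.assoc)+

definition hb_closed_span :: "hardy_bidisc set \<Rightarrow> hardy_bidisc set"
  where "hb_closed_span X = closure (hb.span X)"

(* f (x) g is the function f(z_1) g(z_2); for f and g in the Hardy space of the disc
   it exists and is unique, see elementary_tensor_exists. *)
definition elementary_tensors ::
    "(complex \<Rightarrow> complex) set \<Rightarrow> (complex \<Rightarrow> complex) set \<Rightarrow> hardy_bidisc set"
  where "elementary_tensors M N =
           {h. \<exists>f\<in>M. \<exists>g\<in>N. \<forall>z\<in>unit_disc. \<forall>w\<in>unit_disc. hb_fun h (z, w) = f z * g w}"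

lemma elementary_tensor_exists:
  assumes "f \<in> hardy_disc" "g \<in> hardy_disc"
  shows "\<exists>!h. \<forall>z\<in>unit_disc. \<forall>w\<in>unit_disc. hb_fun h (z, w) = f z * g w"
proof (rule ex_ex1I)
  obtain a where a: "square_summable a" "\<And>z. z \<in> unit_disc \<Longrightarrow> (\<lambda>n. a n * z ^ n) sums f z"
    using assms(1) by (auto simp: hardy_disc_def)
  obtain b where b: "square_summable b" "\<And>z. z \<in> unit_disc \<Longrightarrow> (\<lambda>n. b n * z ^ n) sums g z"
    using assms(2) by (auto simp: hardy_disc_def)
  have sums_has_sum: "((\<lambda>n. c n * z ^ n) has_sum s) UNIV"
    if "square_summable c" "z \<in> unit_disc" "(\<lambda>n. c n * z ^ n) sums s" for c z s
    using square_summable_mult[OF that(1) square_summable_powers[OF that(2)]]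
    by (intro norm_summable_imp_has_sum that(3) summable_on_imp_summable)
  define d where "d = (\<lambda>(m, n). a m * b n)"
  have d: "square_summable d"
    unfolding d_def by (rule square_summable_tensor[OF a(1) b(1)])
  have "bidisc_series d (z, w) = f z * g w" if z: "z \<in> unit_disc" and w: "w \<in> unit_disc" for z w
  proof -
    have "((\<lambda>(m, n). d (m, n) * z ^ m * w ^ n) has_sum bidisc_series d (z, w)) (UNIV \<times> UNIV)"
      using has_sum_bidisc_series[OF d z w] by simp
    then have "((\<lambda>m. (a m * z ^ m) * g w) has_sum bidisc_series d (z, w)) UNIV"
    proof (rule has_sum_SigmaD)
      fix m
      show "((\<lambda>n. case (m, n) of (m, n) \<Rightarrow> d (m, n) * z ^ m * w ^ n) has_sum (a m * z ^ m) * g w) UNIV"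
        using has_sum_cmult_right[OF sums_has_sum[OF b(1) w b(2)[OF w]], of "a m * z ^ m"]
        by (simp add: d_def mult_ac)
    qed
    moreover have "((\<lambda>m. (a m * z ^ m) * g w) has_sum f z * g w) UNIV"
      by (rule has_sum_cmult_left[OF sums_has_sum[OF a(1) z a(2)[OF z]]])
    ultimately show ?thesis
      by (rule has_sum_unique)
  qed
  moreover have "hb_fun (hb_Abs (bidisc_series d)) = bidisc_series d"
    using d by (intro hb_Abs_inverse) (auto simp: bidisc_functions_def)
  ultimately show "\<exists>h. \<forall>z\<in>unit_disc. \<forall>w\<in>unit_disc. hb_fun h (z, w) = f z * g w"
    by (intro exI[of _ "hb_Abs (bidisc_series d)"]) simp
next
  fix h k
  assume hk: "\<forall>z\<in>unit_disc. \<forall>w\<in>unit_disc. hb_fun h (z, w) = f z * g w"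
    "\<forall>z\<in>unit_disc. \<forall>w\<in>unit_disc. hb_fun k (z, w) = f z * g w"
  have "hb_fun h (z, w) = hb_fun k (z, w)" for z w
  proof (cases "z \<in> unit_disc \<and> w \<in> unit_disc")
    case True
    with hk show ?thesis by simp
  next
    case False
    then show ?thesis
      unfolding hb_coeff(2)[symmetric] bidisc_series_def by auto
  qed
  then have "hb_fun h = hb_fun k"
    by auto
  then show "h = k"
    by (simp add: hb_fun_inject)
qed

definition hilbert_tensor ::
    "(complex \<Rightarrow> complex) set \<Rightarrow> (complex \<Rightarrow> complex) set \<Rightarrow> hardy_bidisc set"
  where "hilbert_tensor M N = hb_closed_span (elementary_tensors M N)"

definition multiples :: "(complex \<Rightarrow> complex) \<Rightarrow> (complex \<Rightarrow> complex) set"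
  where "multiples \<psi> = (\<lambda>f z. \<psi> z * f z) ` hardy_disc"

lemma bidisc_series_shift1:
  assumes "square_summable a"
  defines "b \<equiv> \<lambda>(m, n). case m of 0 \<Rightarrow> 0 | Suc m \<Rightarrow> a (m, n)"
  shows "square_summable b" "bidisc_series b = (\<lambda>p. fst p * bidisc_series a p)"
proof -
  let ?h = "\<lambda>(m, n). (Suc m, n) :: nat \<times> nat"
  have h: "inj ?h" by (auto intro!: injI)
  have nh: "b j = 0" if "j \<notin> range ?h" for j
    using that unfolding b_def by (cases j; cases "fst j") (auto simp: image_iff)
  show b: "square_summable b"
    by (rule square_summable_reindex[OF assms(1) h nh]) (auto simp: b_def)
  show "bidisc_series b = (\<lambda>p. fst p * bidisc_series a p)"
  proof
    fix p :: "complex \<times> complex"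
    obtain z w where p: "p = (z, w)" by force
    have "(\<Sum>\<^sub>\<infinity>(m, n)\<in>UNIV. b (m, n) * z ^ m * w ^ n) = (\<Sum>\<^sub>\<infinity>(m, n)\<in>range ?h. b (m, n) * z ^ m * w ^ n)"
      using nh by (intro infsum_cong_neutral) auto
    also have "\<dots> = (\<Sum>\<^sub>\<infinity>(m, n)\<in>UNIV. z * (a (m, n) * z ^ m * w ^ n))"
      by (subst infsum_reindex[OF h]) (auto simp: o_def b_def case_prod_unfold mult_ac intro!: infsum_cong)
    also have "\<dots> = z * (\<Sum>\<^sub>\<infinity>(m, n)\<in>UNIV. a (m, n) * z ^ m * w ^ n)"
      by (simp add: case_prod_unfold infsum_cmult_right')
    finally show "bidisc_series b p = fst p * bidisc_series a p"
      by (simp add: p bidisc_series_def)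
  qed
qed

lemma bidisc_series_shift2:
  assumes "square_summable a"
  defines "b \<equiv> \<lambda>(m, n). case n of 0 \<Rightarrow> 0 | Suc n \<Rightarrow> a (m, n)"
  shows "square_summable b" "bidisc_series b = (\<lambda>p. snd p * bidisc_series a p)"
proof -
  let ?h = "\<lambda>(m, n). (m, Suc n) :: nat \<times> nat"
  have h: "inj ?h" by (auto intro!: injI)
  have nh: "b j = 0" if "j \<notin> range ?h" for j
    using that unfolding b_def by (cases j; cases "snd j") (auto simp: image_iff)
  show b: "square_summable b"
    by (rule square_summable_reindex[OF assms(1) h nh]) (auto simp: b_def)
  show "bidisc_series b = (\<lambda>p. snd p * bidisc_series a p)"
  proof
    fix p :: "complex \<times> complex"
    obtain z w where p: "p = (z, w)" by force
    have "(\<Sum>\<^sub>\<infinity>(m, n)\<in>UNIV. b (m, n) * z ^ m * w ^ n) = (\<Sum>\<^sub>\<infinity>(m, n)\<in>range ?h. b (m, n) * z ^ m * w ^ n)"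
      using nh by (intro infsum_cong_neutral) auto
    also have "\<dots> = (\<Sum>\<^sub>\<infinity>(m, n)\<in>UNIV. w * (a (m, n) * z ^ m * w ^ n))"
      by (subst infsum_reindex[OF h]) (auto simp: o_def b_def case_prod_unfold mult_ac intro!: infsum_cong)
    also have "\<dots> = w * (\<Sum>\<^sub>\<infinity>(m, n)\<in>UNIV. a (m, n) * z ^ m * w ^ n)"
      by (simp add: case_prod_unfold infsum_cmult_right')
    finally show "bidisc_series b p = snd p * bidisc_series a p"
      by (simp add: p bidisc_series_def)
  qed
qed

lift_definition mult_z1 :: "hardy_bidisc \<Rightarrow> hardy_bidisc" is "\<lambda>f p. fst p * f p"
proof -
  fix f
  assume "f \<in> bidisc_functions"
  then obtain a where a: "square_summable a" "f = bidisc_series a"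
    by (auto simp: bidisc_functions_def)
  show "(\<lambda>p. fst p * f p) \<in> bidisc_functions"
    unfolding a(2) bidisc_series_shift1(2)[OF a(1), symmetric]
    using bidisc_series_shift1(1)[OF a(1)] by (auto simp: bidisc_functions_def)
qed

lift_definition mult_z2 :: "hardy_bidisc \<Rightarrow> hardy_bidisc" is "\<lambda>f p. snd p * f p"
proof -
  fix f
  assume "f \<in> bidisc_functions"
  then obtain a where a: "square_summable a" "f = bidisc_series a"
    by (auto simp: bidisc_functions_def)
  show "(\<lambda>p. snd p * f p) \<in> bidisc_functions"
    unfolding a(2) bidisc_series_shift2(2)[OF a(1), symmetric]
    using bidisc_series_shift2(1)[OF a(1)] by (auto simp: bidisc_functions_def)
qed

definition hb_ominus :: "hardy_bidisc set \<Rightarrow> hardy_bidisc set \<Rightarrow> hardy_bidisc set"  (infix "\<ominus>\<^sub>H" 66)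
  where "S \<ominus>\<^sub>H T = {f \<in> S. \<forall>g\<in>T. hb_cinner f g = 0}"

definition z_range :: "hardy_bidisc set \<Rightarrow> hardy_bidisc set"
  where "z_range S = {mult_z1 f + mult_z2 g | f g. f \<in> S \<and> g \<in> S}"

definition blaschke :: "complex \<Rightarrow> complex \<Rightarrow> complex"
  where "blaschke \<alpha> z = (if \<alpha> = 0 then z
           else - cnj \<alpha> / of_real (cmod \<alpha>) * ((z - \<alpha>) / (1 - cnj \<alpha> * z)))"

(* The library's infinite product may have finitely many zero factors,
   so the product has the intended value also at the zeros of the Blaschke factors. *)
definition blaschke_tail :: "(nat \<Rightarrow> complex) \<Rightarrow> (nat \<Rightarrow> nat) \<Rightarrow> nat \<Rightarrow> complex \<Rightarrow> complex"
  where "blaschke_tail \<alpha> l n z = (\<Prod>i. blaschke (\<alpha> (n + i)) z ^ l (n + i))"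

definition rudin_submodule :: "(nat \<Rightarrow> complex \<Rightarrow> complex) \<Rightarrow> hardy_bidisc set"
  where "rudin_submodule \<phi> =
           hb_closed_span (\<Union>n. hilbert_tensor (multiples (\<lambda>z. z ^ n)) (multiples (\<phi> n)))"

end

theory Submission
  imports Defs
begin

text \<open>
  Write a function on the bidisc as a power series in \<open>z\<^sub>1\<close> with coefficients \<open>f\<^sub>m(z\<^sub>2)\<close> in the
  Hardy space of the disc, and let \<open>b\<^sub>n\<close> be the finite Blaschke product with
  \<open>\<phi>\<^sub>n = b\<^sub>n \<phi>\<^sub>n\<^sub>+\<^sub>1\<close>. Since the spaces \<open>\<phi>\<^sub>n H\<^sup>2\<close> increase with \<open>n\<close>, every \<open>f\<close> in the Rudin submodule
  has \<open>f\<^sub>m \<in> \<phi>\<^sub>m H\<^sup>2\<close> for all \<open>m\<close>. If \<open>f\<close> is orthogonal to \<open>z\<^sub>2 S\<close>, then \<open>f\<^sub>m\<close> lies in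
  \<open>\<phi>\<^sub>m H\<^sup>2 \<ominus> z \<phi>\<^sub>m H\<^sup>2\<close>, which is the line spanned by \<open>\<phi>\<^sub>m\<close>. If \<open>f\<close> is also orthogonal to \<open>z\<^sub>1 S\<close>, then
  \<open>f\<^sub>m\<^sub>+\<^sub>1 = c \<phi>\<^sub>m\<^sub>+\<^sub>1\<close> is orthogonal to \<open>\<phi>\<^sub>m H\<^sup>2 = \<phi>\<^sub>m\<^sub>+\<^sub>1 b\<^sub>m H\<^sup>2\<close>, and pairing with \<open>\<phi>\<^sub>m\<^sub>+\<^sub>1 b\<^sub>m\<close> leaves \<open>c\<close> times
  the conjugate of \<open>b\<^sub>m(0)\<close>. So \<open>c\<close> can be nonzero only if \<open>b\<^sub>m(0) = 0\<close>, that is, \<open>\<alpha>\<^sub>m = 0\<close>, and in that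
  case \<open>z\<^sub>1\<^sup>m\<^sup>+\<^sup>1 \<phi>\<^sub>m\<^sub>+\<^sub>1(z\<^sub>2)\<close> is indeed orthogonal to both ranges. Together with \<open>\<phi>\<^sub>0(z\<^sub>2)\<close>
  these functions form a basis, which is finite because each \<open>\<alpha>\<^sub>n = 0\<close> contributes at least 1
  to the convergent Blaschke sum.

  The tool throughout is that multiplication by \<open>\<phi>\<^sub>n\<close> and by \<open>b\<^sub>n\<close> is an isometry of \<open>H\<^sup>2\<close>, which is proved
  without boundary values. For one Blaschke factor it is the identity
  \<open>\<parallel>z x - \<alpha> x\<parallel> = \<parallel>x - cnj \<alpha> z x\<parallel>\<close>, a consequence of \<open>\<parallel>z x\<parallel> = \<parallel>x\<parallel>\<close>. For the infinite product
  (lemma \<open>isometric_multiplier_infinite_product\<close>) it follows from \<open>\<phi>\<^sub>n \<rightarrow> 1\<close> and the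
  lower semicontinuity of the norm under coefficientwise convergence. The convergence \<open>\<phi>\<^sub>n \<rightarrow> 1\<close> comes from
  the estimate \<open>norm_blaschke_minus_1_le\<close>. Lemma \<open>rows_of_wandering_vector\<close>
  carries out the orthogonality argument above.
\<close>

unbundle no vec_syntax
unbundle fps_syntax

section \<open>Square-summable power series\<close>

definition hardy_fps :: "complex fps set"
  where "hardy_fps = {A. square_summable (fps_nth A)}"

definition fps_sqnorm :: "complex fps \<Rightarrow> real"
  where "fps_sqnorm A = (\<Sum>\<^sub>\<infinity>k. (cmod (A $ k))\<^sup>2)"

definition fps_cinner :: "complex fps \<Rightarrow> complex fps \<Rightarrow> complex"
  where "fps_cinner A B = (\<Sum>\<^sub>\<infinity>k. A $ k * cnj (B $ k))"

lemma hardy_fps_bounded: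
  assumes "\<And>n. (\<Sum>k<n. (cmod (A $ k))\<^sup>2) \<le> C"
  shows "A \<in> hardy_fps" "fps_sqnorm A \<le> C"
proof -
  have fin: "(\<Sum>k\<in>F. (cmod (A $ k))\<^sup>2) \<le> C" if "finite F" for F
  proof -
    obtain n where "F \<subseteq> {..<n}"
      using finite_nat_iff_bounded[of F] \<open>finite F\<close> by blast
    then have "(\<Sum>k\<in>F. (cmod (A $ k))\<^sup>2) \<le> (\<Sum>k<n. (cmod (A $ k))\<^sup>2)"
      by (intro sum_mono2) auto
    also have "\<dots> \<le> C" by (rule assms)
    finally show ?thesis .
  qed
  have *: "(\<lambda>k. (cmod (A $ k))\<^sup>2) summable_on UNIV"
    by (rule nonneg_bdd_above_summable_on) (auto intro!: bdd_aboveI2 fin)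
  then show "A \<in> hardy_fps"
    by (simp add: hardy_fps_def square_summable_def)
  show "fps_sqnorm A \<le> C"
    unfolding fps_sqnorm_def by (rule infsum_le_finite_sums[OF *]) (rule fin)
qed

lemma sum_le_fps_sqnorm:
  assumes "A \<in> hardy_fps" "finite F"
  shows "(\<Sum>k\<in>F. (cmod (A $ k))\<^sup>2) \<le> fps_sqnorm A"
  using assms unfolding fps_sqnorm_def hardy_fps_def square_summable_def
  by (intro finite_sum_le_infsum) auto

lemma nth_le_fps_sqnorm:
  assumes "A \<in> hardy_fps"
  shows "cmod (A $ k) \<le> sqrt (fps_sqnorm A)"
  using sum_le_fps_sqnorm[OF assms, of "{k}"] by (intro real_le_rsqrt) simp

text \<open>Fatou's lemma for sequence spaces: it replaces completeness and weak compactness in all limit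
  arguments below.\<close>

lemma hardy_fps_coefficientwise_limit:
  assumes "\<And>k. (\<lambda>j. A j $ k) \<longlonglongrightarrow> B $ k"
    and "\<And>j. A j \<in> hardy_fps" "\<And>j. fps_sqnorm (A j) \<le> C"
  shows "B \<in> hardy_fps" "fps_sqnorm B \<le> C"
proof -
  have "(\<Sum>k<n. (cmod (B $ k))\<^sup>2) \<le> C" for n
  proof (rule LIMSEQ_le_const2)
    show "(\<lambda>j. \<Sum>k<n. (cmod (A j $ k))\<^sup>2) \<longlonglongrightarrow> (\<Sum>k<n. (cmod (B $ k))\<^sup>2)"
      by (intro tendsto_intros assms(1))
    show "\<exists>N. \<forall>j\<ge>N. (\<Sum>k<n. (cmod (A j $ k))\<^sup>2) \<le> C"
      using sum_le_fps_sqnorm[OF assms(2)] assms(3) by (meson finite_lessThan order_trans)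
  qed
  from hardy_fps_bounded[OF this] show "B \<in> hardy_fps" "fps_sqnorm B \<le> C" .
qed

lemma hardy_fps_add: "A \<in> hardy_fps \<Longrightarrow> B \<in> hardy_fps \<Longrightarrow> A + B \<in> hardy_fps"
  using square_summable_add[of "fps_nth A" "fps_nth B"]
  by (simp add: hardy_fps_def square_summable_def)

lemma hardy_fps_scale: "A \<in> hardy_fps \<Longrightarrow> fps_const c * A \<in> hardy_fps"
  using square_summable_scale[of "fps_nth A" c] by (simp add: hardy_fps_def square_summable_def)

lemma hardy_fps_diff: "A \<in> hardy_fps \<Longrightarrow> B \<in> hardy_fps \<Longrightarrow> A - B \<in> hardy_fps"
  using hardy_fps_add[OF _ hardy_fps_scale[of B "-1"], of A] by (simp flip: fps_const_neg)

lemma zero_in_hardy_fps: "0 \<in> hardy_fps"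
  by (simp add: hardy_fps_def square_summable_def)

lemma fps_X_power_in_hardy_fps: "fps_X ^ n \<in> hardy_fps"
  by (rule hardy_fps_bounded(1)[where C = 1]) (auto simp: if_distrib[of cmod] if_distrib[of "\<lambda>x. x\<^sup>2"] sum.delta cong: if_cong)

lemma one_in_hardy_fps: "1 \<in> hardy_fps"
  using fps_X_power_in_hardy_fps[of 0] by simp

lemma fps_cinner_has_sum:
  assumes "A \<in> hardy_fps" "B \<in> hardy_fps"
  shows "((\<lambda>k. A $ k * cnj (B $ k)) has_sum fps_cinner A B) UNIV"
proof -
  have "square_summable (\<lambda>k. cnj (B $ k))"
    using assms(2) by (simp add: hardy_fps_def square_summable_def)
  from abs_summable_summable[OF square_summable_mult[OF _ this, of "fps_nth A"]] assms(1)
  show ?thesis by (simp add: fps_cinner_def hardy_fps_def)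
qed

lemma fps_cinner_commute: "fps_cinner B A = cnj (fps_cinner A B)"
  by (simp add: fps_cinner_def mult.commute flip: infsum_cnj)

lemma fps_cinner_X_power: "fps_cinner A (fps_X ^ j) = A $ j"
  unfolding fps_cinner_def
  by (intro infsumI has_sum_finite_neutralI[of "{j}"]) auto

lemma fps_cinner_const_left: "fps_cinner (fps_const c) A = c * cnj (A $ 0)"
  unfolding fps_cinner_def
  by (intro infsumI has_sum_finite_neutralI[of "{0}"]) auto

text \<open>The cosine law, used in two ways: to compare norms, and to recover inner products from norms by varying \<open>c\<close>.\<close>

lemma fps_sqnorm_add_scale:
  assumes "A \<in> hardy_fps" "B \<in> hardy_fps"
  shows "fps_sqnorm (A + fps_const c * B)
    = fps_sqnorm A + (cmod c)\<^sup>2 * fps_sqnorm B + 2 * Re (cnj c * fps_cinner A B)"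
proof -
  have 1: "((\<lambda>k. (cmod (A $ k))\<^sup>2) has_sum fps_sqnorm A) UNIV"
    "((\<lambda>k. (cmod (B $ k))\<^sup>2) has_sum fps_sqnorm B) UNIV"
    using assms by (simp_all add: hardy_fps_def square_summable_def fps_sqnorm_def)
  have "((\<lambda>k. (cmod (A $ k))\<^sup>2 + (cmod c)\<^sup>2 * (cmod (B $ k))\<^sup>2 + 2 * Re (cnj c * (A $ k * cnj (B $ k))))
    has_sum (fps_sqnorm A + (cmod c)\<^sup>2 * fps_sqnorm B + 2 * Re (cnj c * fps_cinner A B))) UNIV"
    by (intro has_sum_add has_sum_cmult_right has_sum_Re fps_cinner_has_sum 1 assms)
  moreover have "(cmod (a + c * b))\<^sup>2 = (cmod a)\<^sup>2 + (cmod c)\<^sup>2 * (cmod b)\<^sup>2 + 2 * Re (cnj c * (a * cnj b))"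
    for a b :: complex
    unfolding cmod_power2 by (simp add: algebra_simps power2_eq_square)
  ultimately show ?thesis
    unfolding fps_sqnorm_def by (intro infsumI) simp
qed

section \<open>Isometric multipliers\<close>

text \<open>The power series of the inner functions on the disc: a bounded analytic function
  multiplies the Hardy space isometrically exactly if its boundary values are unimodular.\<close>

definition isometric_multiplier :: "complex fps \<Rightarrow> bool"
  where "isometric_multiplier P \<longleftrightarrow>
    (\<forall>A\<in>hardy_fps. P * A \<in> hardy_fps \<and> fps_sqnorm (P * A) = fps_sqnorm A)"

lemma isometric_multiplierD:
  assumes "isometric_multiplier P" "A \<in> hardy_fps"
  shows "P * A \<in> hardy_fps" "fps_sqnorm (P * A) = fps_sqnorm A"
  using assms by (auto simp: isometric_multiplier_def)

lemma isometric_multiplier_in_hardy_fps: "isometric_multiplier P \<Longrightarrow> P \<in> hardy_fps"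
  using isometric_multiplierD(1)[OF _ one_in_hardy_fps, of P] by simp

lemma isometric_multiplier_one: "isometric_multiplier 1"
  by (simp add: isometric_multiplier_def)

lemma isometric_multiplier_mult:
  "isometric_multiplier P \<Longrightarrow> isometric_multiplier Q \<Longrightarrow> isometric_multiplier (P * Q)"
  by (simp add: isometric_multiplier_def mult.assoc)

lemma isometric_multiplier_power: "isometric_multiplier P \<Longrightarrow> isometric_multiplier (P ^ n)"
  by (induction n) (simp_all add: isometric_multiplier_one isometric_multiplier_mult)

lemma isometric_multiplier_prod:
  "(\<And>i. i \<in> I \<Longrightarrow> isometric_multiplier (P i)) \<Longrightarrow> isometric_multiplier (\<Prod>i\<in>I. P i)"
  by (induction I rule: infinite_finite_induct)
    (simp_all add: isometric_multiplier_one isometric_multiplier_mult)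

lemma isometric_multiplier_nonzero:
  assumes "isometric_multiplier P"
  shows "P \<noteq> 0"
proof
  assume "P = 0"
  then have "fps_sqnorm 0 = fps_sqnorm 1"
    using isometric_multiplierD(2)[OF assms one_in_hardy_fps] by simp
  moreover have "cmod (1 $ 0) \<le> sqrt (fps_sqnorm 1)"
    by (rule nth_le_fps_sqnorm[OF one_in_hardy_fps])
  ultimately show False
    by (simp add: fps_sqnorm_def)
qed

text \<open>By polarization, an isometric multiplier also preserves inner products. In particular
  \<open>P H\<^sup>2 \<ominus> P Q H\<^sup>2\<close> can be computed as \<open>P (H\<^sup>2 \<ominus> Q H\<^sup>2)\<close>.\<close>

lemma isometric_multiplier_cinner:
  assumes P: "isometric_multiplier P" and A: "A \<in> hardy_fps" and B: "B \<in> hardy_fps"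
  shows "fps_cinner (P * A) (P * B) = fps_cinner A B"
proof -
  have "Re (cnj c * fps_cinner (P * A) (P * B)) = Re (cnj c * fps_cinner A B)" for c
  proof -
    have "P * A + fps_const c * (P * B) = P * (A + fps_const c * B)"
      by (simp add: algebra_simps)
    then have "fps_sqnorm (P * A + fps_const c * (P * B)) = fps_sqnorm (A + fps_const c * B)"
      using isometric_multiplierD(2)[OF P hardy_fps_add[OF A hardy_fps_scale[OF B, of c]]] by simp
    then show ?thesis
      using isometric_multiplierD[OF P A] isometric_multiplierD[OF P B] A B
      by (simp add: fps_sqnorm_add_scale)
  qed
  from this[of 1] this[of \<i>] show ?thesis
    by (simp add: complex_eq_iff)
qed

lemma isometric_multiplier_X: "isometric_multiplier fps_X"
  unfolding isometric_multiplier_def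
proof (intro ballI)
  fix A assume A: "A \<in> hardy_fps"
  have *: "((\<lambda>k. (cmod ((fps_X * A) $ k))\<^sup>2) has_sum fps_sqnorm A) UNIV"
  proof -
    have "((\<lambda>k. (cmod ((fps_X * A) $ k))\<^sup>2) has_sum fps_sqnorm A) (range Suc)"
      using A by (subst has_sum_reindex) (auto simp: o_def fps_sqnorm_def hardy_fps_def square_summable_def)
    moreover have "(fps_X * A) $ k = 0" if "k \<notin> range Suc" for k
      using that by (cases k) auto
    ultimately show ?thesis
      by (subst has_sum_cong_neutral[of "range Suc" UNIV]) auto
  qed
  from has_sum_imp_summable[OF *] infsumI[OF *]
  show "fps_X * A \<in> hardy_fps \<and> fps_sqnorm (fps_X * A) = fps_sqnorm A"
    unfolding hardy_fps_def square_summable_def fps_sqnorm_def by blast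
qed

text \<open>The quotient \<open>x\<close> satisfies the recursion \<open>x\<^sub>k = \<alpha> x\<^sub>k\<^sub>-\<^sub>1 + A\<^sub>k\<close>. Convexity of the square gives
  \<open>\<bar>x\<^sub>k\<bar>\<^sup>2 \<le> a \<bar>x\<^sub>k\<^sub>-\<^sub>1\<bar>\<^sup>2 + \<bar>A\<^sub>k\<bar>\<^sup>2 / (1 - a)\<close> with \<open>a = \<bar>\<alpha>\<bar> < 1\<close>, so a partial sum \<open>s\<close> of the \<open>\<bar>x\<^sub>k\<bar>\<^sup>2\<close> is bounded by
  \<open>a s\<close> plus a constant.\<close>

lemma hardy_fps_divide_linear:
  assumes A: "A \<in> hardy_fps" and \<alpha>: "cmod \<alpha> < 1"
  shows "inverse (1 - fps_const \<alpha> * fps_X) * A \<in> hardy_fps"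
proof -
  define x where "x = inverse (1 - fps_const \<alpha> * fps_X) * A"
  define a where "a = cmod \<alpha>"
  have a: "0 \<le> a" "a < 1" using \<alpha> by (auto simp: a_def)
  have "(1 - fps_const \<alpha> * fps_X) * x = A"
    unfolding x_def by (simp flip: mult.assoc add: inverse_mult_eq_1')
  then have x: "x = A + fps_const \<alpha> * (fps_X * x)"
    by (simp add: algebra_simps)
  have step: "(cmod (x $ k))\<^sup>2 \<le> a * (cmod ((fps_X * x) $ k))\<^sup>2 + (cmod (A $ k))\<^sup>2 / (1 - a)" for k
  proof -
    define s t where "s = cmod ((fps_X * x) $ k)" and "t = cmod (A $ k)"
    have "cmod (x $ k) \<le> t + a * s"
      using norm_triangle_ineq[of "A $ k" "\<alpha> * (fps_X * x) $ k"]
      by (subst x) (simp add: s_def t_def a_def norm_mult)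
    then have "(cmod (x $ k))\<^sup>2 \<le> (t + a * s)\<^sup>2"
      by (intro power_mono) auto
    \<comment> \<open>With \<open>u = t / (1 - a)\<close>, the left side is the square of the convex combination \<open>a s + (1 - a) u\<close>.\<close>
    also have "\<dots> = a * s\<^sup>2 + t\<^sup>2 / (1 - a) - a * (1 - a) * (s - t / (1 - a))\<^sup>2"
    proof -
      define u where "u = t / (1 - a)"
      have "t = (1 - a) * u"
        using a by (simp add: u_def)
      moreover from this have "t\<^sup>2 / (1 - a) = (1 - a) * u\<^sup>2"
        using a by (simp add: power2_eq_square)
      ultimately show ?thesis
        by (simp add: u_def[symmetric]) (simp add: algebra_simps power2_eq_square)
    qed
    also have "\<dots> \<le> a * s\<^sup>2 + t\<^sup>2 / (1 - a)"
      using a by (simp add: mult_nonneg_nonneg)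
    finally show ?thesis by (simp add: s_def t_def)
  qed
  have "(\<Sum>k<n. (cmod (x $ k))\<^sup>2) \<le> fps_sqnorm A / (1 - a) / (1 - a)" for n
  proof -
    define S where "S = (\<Sum>k<n. (cmod (x $ k))\<^sup>2)"
    have "(\<Sum>k<n. (cmod ((fps_X * x) $ k))\<^sup>2) \<le> S"
    proof (cases n)
      case (Suc m)
      have "(\<Sum>k<Suc m. (cmod ((fps_X * x) $ k))\<^sup>2) = (\<Sum>k<m. (cmod (x $ k))\<^sup>2)"
        by (subst sum.lessThan_Suc_shift) simp
      also have "\<dots> \<le> (\<Sum>k<Suc m. (cmod (x $ k))\<^sup>2)"
        by simp
      finally show ?thesis unfolding S_def Suc .
    qed (simp add: S_def)
    then have "a * (\<Sum>k<n. (cmod ((fps_X * x) $ k))\<^sup>2) \<le> a * S"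
      using a by (intro mult_left_mono)
    moreover have "S \<le> (\<Sum>k<n. a * (cmod ((fps_X * x) $ k))\<^sup>2 + (cmod (A $ k))\<^sup>2 / (1 - a))"
      unfolding S_def by (intro sum_mono step)
    moreover have "(\<Sum>k<n. (cmod (A $ k))\<^sup>2) / (1 - a) \<le> fps_sqnorm A / (1 - a)"
      using a by (intro divide_right_mono sum_le_fps_sqnorm A) auto
    ultimately have "S \<le> a * S + fps_sqnorm A / (1 - a)"
      unfolding S_def sum.distrib by (simp only: sum_distrib_left[symmetric] sum_divide_distrib[symmetric])
    then have "S * (1 - a) \<le> fps_sqnorm A / (1 - a)"
      by (simp add: algebra_simps)
    then show "(\<Sum>k<n. (cmod (x $ k))\<^sup>2) \<le> fps_sqnorm A / (1 - a) / (1 - a)"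
      unfolding S_def[symmetric] using a by (simp only: pos_le_divide_eq[of "1 - a"] diff_gt_0_iff_gt)
  qed
  from hardy_fps_bounded(1)[OF this] show ?thesis by (simp add: x_def)
qed

text \<open>Put \<open>x = A / (1 - cnj \<alpha> z)\<close>. Then the claim is \<open>\<parallel>z x - \<alpha> x\<parallel> = \<parallel>x - cnj \<alpha> z x\<parallel>\<close>. Expanding both sides
  by the cosine law, the square terms agree because \<open>\<parallel>z x\<parallel> = \<parallel>x\<parallel>\<close>, and the
  cross terms are real parts of conjugate numbers.\<close>

lemma isometric_multiplier_blaschke_factor:
  assumes c: "cmod c = 1" and \<alpha>: "cmod \<alpha> < 1"
  shows "isometric_multiplier
    (fps_const c * ((fps_X - fps_const \<alpha>) / (1 - fps_const (cnj \<alpha>) * fps_X)))"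
  unfolding isometric_multiplier_def
proof (intro ballI)
  fix A assume A: "A \<in> hardy_fps"
  define D where "D = 1 - fps_const (cnj \<alpha>) * fps_X"
  define x where "x = inverse D * A"
  have D0: "D $ 0 \<noteq> 0" by (simp add: D_def)
  have x: "x \<in> hardy_fps"
    using hardy_fps_divide_linear[OF A, of "cnj \<alpha>"] \<alpha> by (simp add: x_def D_def)
  have Xx: "fps_X * x \<in> hardy_fps" "fps_sqnorm (fps_X * x) = fps_sqnorm x"
    using isometric_multiplierD[OF isometric_multiplier_X x] by auto
  have "D * x = A"
    unfolding x_def using D0 by (simp flip: mult.assoc add: inverse_mult_eq_1')
  then have A': "A = x + fps_const (- cnj \<alpha>) * (fps_X * x)"
    by (simp add: D_def algebra_simps flip: fps_const_neg)
  have y: "fps_const c * ((fps_X - fps_const \<alpha>) / D) * A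
      = fps_const c * (fps_X * x + fps_const (- \<alpha>) * x)"
  proof -
    have "fps_X * x + fps_const (- \<alpha>) * x = (fps_X - fps_const \<alpha>) * x"
      by (simp add: left_diff_distrib flip: fps_const_neg)
    then show ?thesis
      using D0 by (simp only: x_def fps_divide_unit[OF D0] mult.assoc)
  qed
  have "fps_sqnorm (0 + fps_const c * (fps_X * x + fps_const (- \<alpha>) * x))
      = fps_sqnorm (fps_X * x + fps_const (- \<alpha>) * x)"
    using c by (subst fps_sqnorm_add_scale)
      (auto intro!: hardy_fps_add hardy_fps_scale zero_in_hardy_fps Xx x simp: fps_sqnorm_def fps_cinner_def)
  also have "\<dots> = fps_sqnorm x + (cmod \<alpha>)\<^sup>2 * fps_sqnorm x + 2 * Re (- cnj \<alpha> * fps_cinner (fps_X * x) x)"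
    using fps_sqnorm_add_scale[OF Xx(1) x, of "- \<alpha>"] Xx(2) by simp
  also have "Re (- cnj \<alpha> * fps_cinner (fps_X * x) x) = Re (cnj (- cnj \<alpha>) * fps_cinner x (fps_X * x))"
    by (subst fps_cinner_commute[of "fps_X * x"]) simp
  also have "fps_sqnorm x + (cmod \<alpha>)\<^sup>2 * fps_sqnorm x + 2 * \<dots> = fps_sqnorm A"
    using fps_sqnorm_add_scale[OF x Xx(1), of "- cnj \<alpha>"] Xx(2) by (simp add: A')
  finally have "fps_sqnorm (fps_const c * (fps_X * x + fps_const (- \<alpha>) * x)) = fps_sqnorm A"
    by simp
  moreover have "fps_const c * (fps_X * x + fps_const (- \<alpha>) * x) \<in> hardy_fps"
    by (intro hardy_fps_scale hardy_fps_add Xx x)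
  ultimately show "fps_const c * ((fps_X - fps_const \<alpha>) / (1 - fps_const (cnj \<alpha>) * fps_X)) * A \<in> hardy_fps
      \<and> fps_sqnorm (fps_const c * ((fps_X - fps_const \<alpha>) / (1 - fps_const (cnj \<alpha>) * fps_X)) * A) = fps_sqnorm A"
    unfolding y[unfolded D_def] by simp
qed

text \<open>Write \<open>\<Phi>\<^sub>n = P\<^sub>M \<Phi>\<^sub>n\<^sub>+\<^sub>M\<close>, where \<open>P\<^sub>M\<close> is a finite product and hence isometric. As \<open>\<Phi>\<^sub>n\<^sub>+\<^sub>M \<rightarrow> 1\<close>, the series
  \<open>P\<^sub>M A\<close>, all of norm \<open>\<parallel>A\<parallel>\<close>, converge to \<open>\<Phi>\<^sub>n A\<close>, so \<open>\<parallel>\<Phi>\<^sub>n A\<parallel> \<le> \<parallel>A\<parallel>\<close>. The series \<open>\<Phi>\<^sub>n\<^sub>+\<^sub>M A\<close>,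
  all of norm \<open>\<parallel>P\<^sub>M \<Phi>\<^sub>n\<^sub>+\<^sub>M A\<parallel> = \<parallel>\<Phi>\<^sub>n A\<parallel>\<close>, converge to \<open>A\<close>, which gives the reverse inequality.\<close>

lemma isometric_multiplier_infinite_product:
  assumes rec: "\<And>n. \<Phi> n = B n * \<Phi> (Suc n)"
    and B: "\<And>n. isometric_multiplier (B n)"
    and lim: "\<And>k. (\<lambda>n. \<Phi> n $ k) \<longlonglongrightarrow> 1 $ k"
  shows "isometric_multiplier (\<Phi> n)"
proof -
  define P where "P n M = (\<Prod>i<M. B (n + i))" for n M
  have P: "isometric_multiplier (P n M)" for n M
    unfolding P_def by (intro isometric_multiplier_prod B)
  have \<Phi>P: "\<Phi> n = P n M * \<Phi> (n + M)" for n M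
  proof (induction M)
    case (Suc M)
    then show ?case using rec[of "n + M"] by (simp add: P_def mult.assoc)
  qed (simp add: P_def)
  have lim': "(\<lambda>M. (\<Phi> (n + M) - 1) $ k) \<longlonglongrightarrow> 0" for n k
    using LIMSEQ_ignore_initial_segment[OF LIM_zero[OF lim[of k]], of n]
    by (simp add: add.commute)
  \<comment> \<open>Coefficients of \<open>C\<^sub>M\<close> are bounded by its norm, so a factor tending to 0 coefficientwise makes the product do so.\<close>
  have vanish: "(\<lambda>M. ((\<Phi> (n + M) - 1) * C M) $ k) \<longlonglongrightarrow> 0"
    if C: "\<And>M. C M \<in> hardy_fps" "\<And>M. fps_sqnorm (C M) = K" for C n k K
    unfolding fps_mult_nth
  proof (rule tendsto_null_sum)
    fix i
    show "(\<lambda>M. (\<Phi> (n + M) - 1) $ i * C M $ (k - i)) \<longlonglongrightarrow> 0"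
    proof (rule tendsto_0_le[where K = "sqrt K", OF lim'[of n i]], rule always_eventually, rule allI)
      fix M
      have "cmod (C M $ (k - i)) \<le> sqrt K"
        using nth_le_fps_sqnorm[OF C(1)[of M], of "k - i"] C(2)[of M] by simp
      then show "cmod ((\<Phi> (n + M) - 1) $ i * C M $ (k - i)) \<le> cmod ((\<Phi> (n + M) - 1) $ i) * sqrt K"
        by (simp add: norm_mult mult_left_mono del: fps_sub_nth)
    qed
  qed
  have contraction: "\<Phi> n * A \<in> hardy_fps" "fps_sqnorm (\<Phi> n * A) \<le> fps_sqnorm A"
    if A: "A \<in> hardy_fps" for A n
  proof -
    note PA = isometric_multiplierD[OF P A]
    have "(\<lambda>M. (P n M * A) $ k) \<longlonglongrightarrow> (\<Phi> n * A) $ k" for k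
    proof -
      \<comment> \<open>This avoids inverting \<open>\<Phi> (n + M)\<close> to get at the convergence of \<open>P n M\<close>.\<close>
      have "(\<Phi> n * A) $ k - ((\<Phi> (n + M) - 1) * (P n M * A)) $ k = (P n M * A) $ k" for M
      proof -
        have "\<Phi> n * A - (\<Phi> (n + M) - 1) * (P n M * A) = P n M * A"
          by (subst \<Phi>P[of n M]) (simp add: algebra_simps)
        then show ?thesis by (metis fps_sub_nth)
      qed
      moreover have "(\<lambda>M. (\<Phi> n * A) $ k - ((\<Phi> (n + M) - 1) * (P n M * A)) $ k) \<longlonglongrightarrow> (\<Phi> n * A) $ k - 0"
        by (intro tendsto_diff tendsto_const vanish[where K = "fps_sqnorm A"] PA)
      ultimately show ?thesis by simp
    qed
    from hardy_fps_coefficientwise_limit[OF this PA(1), of "fps_sqnorm A"] PA(2)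
    show "\<Phi> n * A \<in> hardy_fps" "fps_sqnorm (\<Phi> n * A) \<le> fps_sqnorm A" by auto
  qed
  show ?thesis
    unfolding isometric_multiplier_def
  proof (intro ballI conjI antisym contraction)
    fix A assume A: "A \<in> hardy_fps"
    have "(\<lambda>M. (\<Phi> (n + M) * A) $ k) \<longlonglongrightarrow> A $ k" for k
    proof -
      have "(\<lambda>M. ((\<Phi> (n + M) - 1) * A) $ k + A $ k) \<longlonglongrightarrow> 0 + A $ k"
        by (intro tendsto_add tendsto_const vanish[where K = "fps_sqnorm A"] A) simp
      then show ?thesis by (simp add: algebra_simps)
    qed
    moreover have "fps_sqnorm (\<Phi> (n + M) * A) \<le> fps_sqnorm (\<Phi> n * A)" for M
      using isometric_multiplierD(2)[OF P contraction(1)[OF A], of n M "n + M"]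
      by (simp add: \<Phi>P[of n M] mult.assoc)
    ultimately show "fps_sqnorm A \<le> fps_sqnorm (\<Phi> n * A)"
      by (rule hardy_fps_coefficientwise_limit(2)[OF _ contraction(1)[OF A]])
  qed
qed

section \<open>Functions on the bidisc as sequences of power series\<close>

text \<open>The coefficient of \<open>z\<^sub>1\<^sup>m\<close>, as a power series in \<open>z\<^sub>2\<close>.\<close>

definition hb_row :: "hardy_bidisc \<Rightarrow> nat \<Rightarrow> complex fps"
  where "hb_row h m = Abs_fps (\<lambda>k. hb_coeff h (m, k))"

lemma row_nth [simp]: "hb_row h m $ k = hb_coeff h (m, k)"
  by (simp add: hb_row_def)

lemma hb_eqI_rows: "(\<And>m. hb_row f m = hb_row g m) \<Longrightarrow> f = g"
  unfolding hb_eq_iff fps_eq_iff by (auto simp: fun_eq_iff)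

lemma row_zero [simp]: "hb_row 0 m = 0"
  by (simp add: fps_eq_iff hb_coeff_zero)

lemma row_add: "hb_row (f + g) m = hb_row f m + hb_row g m"
  by (simp add: fps_eq_iff hb_coeff_add)

lemma row_scale: "hb_row (hb_scale c f) m = fps_const c * hb_row f m"
  by (simp add: fps_eq_iff hb_coeff_scale)

lemma row_diff: "hb_row (f - g) m = hb_row f m - hb_row g m"
  using row_add[of "f - g" g m] by simp

lemma row_sum: "hb_row (\<Sum>i\<in>I. f i) m = (\<Sum>i\<in>I. hb_row (f i) m)"
  by (induction I rule: infinite_finite_induct) (simp_all add: row_add)

lemma row_in_hardy_fps: "hb_row h m \<in> hardy_fps"
  and row_sqnorm_le: "fps_sqnorm (hb_row h m) \<le> (norm h)\<^sup>2"
proof -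
  have s: "(\<lambda>p. (cmod (hb_coeff h p))\<^sup>2) summable_on UNIV"
    using hb_coeff(1)[of h] by (simp add: square_summable_def)
  have "(\<Sum>k<n. (cmod (hb_row h m $ k))\<^sup>2) \<le> (norm h)\<^sup>2" for n
  proof -
    have "(\<Sum>k<n. (cmod (hb_row h m $ k))\<^sup>2) = (\<Sum>p\<in>Pair m ` {..<n}. (cmod (hb_coeff h p))\<^sup>2)"
      by (subst sum.reindex) (auto simp: inj_on_def)
    also have "\<dots> \<le> (\<Sum>\<^sub>\<infinity>p. (cmod (hb_coeff h p))\<^sup>2)"
      by (rule finite_sum_le_infsum[OF s]) auto
    also have "\<dots> = (norm h)\<^sup>2"
      by (simp add: power2_norm_eq_inner[of h] inner_hardy_bidisc_def hb_cinner_self)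
    finally show ?thesis .
  qed
  from hardy_fps_bounded[OF this] show "hb_row h m \<in> hardy_fps" "fps_sqnorm (hb_row h m) \<le> (norm h)\<^sup>2" .
qed

lemma hb_coeff_exists:
  assumes "square_summable a"
  shows "\<exists>h. hb_coeff h = a"
proof -
  have "hb_fun (hb_Abs (bidisc_series a)) = bidisc_series a"
    using assms by (intro hb_Abs_inverse) (auto simp: bidisc_functions_def)
  then have "hb_coeff (hb_Abs (bidisc_series a)) = a"
    by (rule hb_coeffI[OF assms])
  then show ?thesis by blast
qed

lemma row_mult_z1: "hb_row (mult_z1 f) m = (case m of 0 \<Rightarrow> 0 | Suc k \<Rightarrow> hb_row f k)"
proof -
  have "hb_coeff (mult_z1 f) = (\<lambda>(m, n). case m of 0 \<Rightarrow> 0 | Suc m \<Rightarrow> hb_coeff f (m, n))"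
    using bidisc_series_shift1[OF hb_coeff(1)[of f]]
    by (intro hb_coeffI) (simp_all add: mult_z1.rep_eq hb_coeff(2))
  then show ?thesis by (auto simp: fps_eq_iff split: nat.split)
qed

lemma row_mult_z2: "hb_row (mult_z2 f) m = fps_X * hb_row f m"
proof -
  have "hb_coeff (mult_z2 f) = (\<lambda>(m, n). case n of 0 \<Rightarrow> 0 | Suc n \<Rightarrow> hb_coeff f (m, n))"
    using bidisc_series_shift2[OF hb_coeff(1)[of f]]
    by (intro hb_coeffI) (simp_all add: mult_z2.rep_eq hb_coeff(2))
  then show ?thesis by (auto simp: fps_eq_iff split: nat.split)
qed

lemma hb_cinner_zero_left: "hb_cinner 0 g = 0"
  by (simp add: hb_cinner_def hb_coeff_zero)

lemma hb_cinner_single_row: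
  assumes "\<And>i. i \<noteq> m \<Longrightarrow> hb_row g i = 0"
  shows "hb_cinner f g = fps_cinner (hb_row f m) (hb_row g m)"
proof -
  have 0: "hb_coeff g p = 0" if "p \<notin> range (Pair m)" for p
  proof -
    obtain i k where p: "p = (i, k)" by force
    with that have "hb_row g i $ k = 0"
      by (subst assms) auto
    then show ?thesis by (simp add: p)
  qed
  have "hb_cinner f g = (\<Sum>\<^sub>\<infinity>p\<in>range (Pair m). hb_coeff f p * cnj (hb_coeff g p))"
    unfolding hb_cinner_def by (rule infsum_cong_neutral) (auto simp: 0)
  also have "\<dots> = fps_cinner (hb_row f m) (hb_row g m)"
    unfolding fps_cinner_def by (subst infsum_reindex) (auto simp: inj_on_def o_def)
  finally show ?thesis .
qed

definition hardy_series :: "(complex \<Rightarrow> complex) \<Rightarrow> complex fps \<Rightarrow> bool"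
  where "hardy_series f A \<longleftrightarrow>
    A \<in> hardy_fps \<and> (\<forall>z\<in>unit_disc. (\<lambda>n. A $ n * z ^ n) sums f z)"

lemma hardy_disc_iff: "f \<in> hardy_disc \<longleftrightarrow> (\<exists>A. hardy_series f A)"
proof
  assume "f \<in> hardy_disc"
  then obtain a where "square_summable a" "\<forall>z\<in>unit_disc. (\<lambda>n. a n * z ^ n) sums f z"
    by (auto simp: hardy_disc_def)
  then have "hardy_series f (Abs_fps a)"
    by (simp add: hardy_series_def hardy_fps_def square_summable_def)
  then show "\<exists>A. hardy_series f A" ..
qed (auto simp: hardy_disc_def hardy_series_def hardy_fps_def)

lemma hardy_fps_conv_radius:
  assumes "A \<in> hardy_fps"
  shows "1 \<le> fps_conv_radius A"
  unfolding fps_conv_radius_def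
proof (rule conv_radius_geI_ex)
  fix r :: real assume r: "0 < r" "ereal r < 1"
  then have "complex_of_real r \<in> unit_disc" by simp
  from square_summable_mult[OF _ square_summable_powers[OF this], of "fps_nth A"] assms
  have "(\<lambda>n. cmod (A $ n * of_real r ^ n)) summable_on UNIV"
    by (simp add: hardy_fps_def)
  then have "summable (\<lambda>n. A $ n * of_real r ^ n)"
    by (intro summable_norm_cancel[OF summable_on_imp_summable])
  then show "\<exists>z. norm z = r \<and> summable (\<lambda>n. A $ n * z ^ n)"
    using r by (intro exI[of _ "of_real r"]) simp
qed

lemma hardy_series_eval_fps:
  "hardy_series f A \<longleftrightarrow> A \<in> hardy_fps \<and> (\<forall>z\<in>unit_disc. eval_fps A z = f z)"
proof -
  have "(\<lambda>n. A $ n * z ^ n) sums eval_fps A z" if "A \<in> hardy_fps" "z \<in> unit_disc" for z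
  proof (rule sums_eval_fps)
    have "ereal (norm z) < 1"
      using that(2) by simp
    also have "1 \<le> fps_conv_radius A"
      by (rule hardy_fps_conv_radius[OF that(1)])
    finally show "ereal (norm z) < fps_conv_radius A" .
  qed
  then show ?thesis
    unfolding hardy_series_def by (metis sums_unique2)
qed

lemma hardy_series_mult:
  assumes "hardy_series f P" "isometric_multiplier P" "hardy_series g A"
  shows "hardy_series (\<lambda>z. f z * g z) (P * A)"
proof -
  have PA: "P \<in> hardy_fps" "A \<in> hardy_fps"
    using assms by (auto simp: hardy_series_def)
  have "eval_fps (P * A) z = f z * g z" if "z \<in> unit_disc" for z
  proof -
    have "ereal (norm z) < 1"
      using that by simp
    then have "ereal (norm z) < fps_conv_radius P" "ereal (norm z) < fps_conv_radius A"
      using PA[THEN hardy_fps_conv_radius] by (blast intro: less_le_trans)+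
    then show ?thesis
      using assms(1,3) that by (simp add: eval_fps_mult hardy_series_eval_fps)
  qed
  then show ?thesis
    unfolding hardy_series_eval_fps using isometric_multiplierD(1)[OF assms(2) PA(2)] by blast
qed

lemma hardy_series_X_power: "hardy_series (\<lambda>z. z ^ n) (fps_X ^ n)"
  by (simp add: hardy_series_eval_fps fps_X_power_in_hardy_fps)

lemma hardy_series_exists:
  assumes "A \<in> hardy_fps"
  shows "hardy_series (eval_fps A) A"
  using assms by (simp add: hardy_series_eval_fps)

lemma row_tensor:
  assumes f: "hardy_series f A" and g: "hardy_series g B"
    and h: "\<And>z w. z \<in> unit_disc \<Longrightarrow> w \<in> unit_disc \<Longrightarrow> hb_fun h (z, w) = f z * g w"
  shows "hb_row h m = fps_const (A $ m) * B"
proof -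
  define d where "d = (\<lambda>(m, n). A $ m * B $ n)"
  have AB: "square_summable (fps_nth A)" "square_summable (fps_nth B)"
    using f g by (auto simp: hardy_series_def hardy_fps_def)
  then have d: "square_summable d"
    unfolding d_def by (rule square_summable_tensor)
  have sums_has_sum: "((\<lambda>n. c n * z ^ n) has_sum s) UNIV"
    if "square_summable c" "z \<in> unit_disc" "(\<lambda>n. c n * z ^ n) sums s" for c z s
    using square_summable_mult[OF that(1) square_summable_powers[OF that(2)]]
    by (intro norm_summable_imp_has_sum that(3) summable_on_imp_summable)
  have "bidisc_series d (z, w) = f z * g w" if z: "z \<in> unit_disc" and w: "w \<in> unit_disc" for z w
  proof -
    have fA: "((\<lambda>n. A $ n * z ^ n) has_sum f z) UNIV" and gB: "((\<lambda>n. B $ n * w ^ n) has_sum g w) UNIV"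
      using f g z w AB by (auto simp: hardy_series_def intro!: sums_has_sum)
    have "((\<lambda>(m, n). d (m, n) * z ^ m * w ^ n) has_sum bidisc_series d (z, w)) (UNIV \<times> UNIV)"
      using has_sum_bidisc_series[OF d z w] by simp
    then have "((\<lambda>m. (A $ m * z ^ m) * g w) has_sum bidisc_series d (z, w)) UNIV"
    proof (rule has_sum_SigmaD)
      fix m
      show "((\<lambda>n. case (m, n) of (m, n) \<Rightarrow> d (m, n) * z ^ m * w ^ n) has_sum (A $ m * z ^ m) * g w) UNIV"
        using has_sum_cmult_right[OF gB, of "A $ m * z ^ m"] by (simp add: d_def mult_ac)
    qed
    then show ?thesis
      by (rule has_sum_unique) (rule has_sum_cmult_left[OF fA])
  qed
  then have "hb_fun h (z, w) = bidisc_series d (z, w)" for z w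
    using h[of z w] by (cases "z \<in> unit_disc \<and> w \<in> unit_disc")
      (auto simp: bidisc_series_def simp flip: hb_coeff(2))
  then have "hb_coeff h = d"
    by (intro hb_coeffI d) auto
  then show ?thesis
    by (simp add: fps_eq_iff d_def)
qed

text \<open>The function \<open>z\<^sub>1\<^sup>m A(z\<^sub>2)\<close>, meaningful for square-summable \<open>A\<close>.\<close>

definition single_row :: "nat \<Rightarrow> complex fps \<Rightarrow> hardy_bidisc"
  where "single_row m A = (SOME h. hb_coeff h = (\<lambda>(i, k). if i = m then A $ k else 0))"

lemma row_single_row:
  assumes "A \<in> hardy_fps"
  shows "hb_row (single_row m A) i = (if i = m then A else 0)"
proof -
  have "square_summable (\<lambda>(i, k). if i = m then A $ k else 0)"
    by (rule square_summable_reindex[of "fps_nth A" "Pair m"])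
      (use assms in \<open>auto simp: hardy_fps_def inj_on_def\<close>)
  from someI_ex[OF hb_coeff_exists[OF this]]
  show ?thesis
    unfolding single_row_def[symmetric] by (simp add: fps_eq_iff)
qed

section \<open>Rudin submodules of decreasing sequences of inner functions\<close>

text \<open>Because \<open>P\<close> is isometric, convergence of \<open>P G\<^sub>j\<close> makes the \<open>G\<^sub>j\<close> bounded and Cauchy in
  each coefficient. Their coefficientwise limit is square-summable by
  \<open>hardy_fps_coefficientwise_limit\<close>, and its product with \<open>P\<close> is the limit because a coefficient of a product
  involves finitely many coefficients of the factors.\<close>

lemma closed_row_multiples:
  assumes P: "isometric_multiplier P"
  shows "closed {h. \<exists>G\<in>hardy_fps. hb_row h m = P * G}"
  unfolding closed_sequential_limits
proof (intro allI impI, elim conjE)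
  fix h l assume "\<forall>j. h j \<in> {h. \<exists>G\<in>hardy_fps. hb_row h m = P * G}" and lim: "h \<longlonglongrightarrow> l"
  then have "\<forall>j. \<exists>G. G \<in> hardy_fps \<and> hb_row (h j) m = P * G"
    by blast
  then obtain G where G: "\<And>j. G j \<in> hardy_fps" "\<And>j. hb_row (h j) m = P * G j"
    by metis
  have nth_le: "cmod (hb_row f m $ k) \<le> norm f" for f k
    using nth_le_fps_sqnorm[OF row_in_hardy_fps[of f m], of k] real_sqrt_le_mono[OF row_sqnorm_le[of f m]]
    by simp
  have dist_le: "dist (G i $ k) (G j $ k) \<le> dist (h i) (h j)" for i j k
  proof -
    have "hb_row (h i - h j) m = P * (G i - G j)"
      by (simp add: row_diff G right_diff_distrib)
    then have "fps_sqnorm (G i - G j) \<le> (norm (h i - h j))\<^sup>2"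
      using row_sqnorm_le[of "h i - h j" m] isometric_multiplierD(2)[OF P hardy_fps_diff[OF G(1) G(1)]]
      by simp
    from order_trans[OF nth_le_fps_sqnorm[OF hardy_fps_diff[OF G(1) G(1)], of i j k] real_sqrt_le_mono[OF this]]
    show ?thesis by (simp add: dist_norm)
  qed
  have Cauchy: "Cauchy (\<lambda>j. G j $ k)" for k
    using LIMSEQ_imp_Cauchy[OF lim] le_less_trans[OF dist_le] unfolding Cauchy_def by fast
  define g where "g k = lim (\<lambda>j. G j $ k)" for k
  have g: "(\<lambda>j. G j $ k) \<longlonglongrightarrow> g k" for k
    unfolding g_def by (rule convergent_LIMSEQ_iff[THEN iffD1, OF Cauchy_convergent[OF Cauchy]])
  obtain K where K: "\<And>j. norm (h j) \<le> K"
    using convergent_imp_Bseq[OF convergentI[OF lim]] unfolding Bseq_def by blast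
  have "fps_sqnorm (G j) \<le> K\<^sup>2" for j
    using row_sqnorm_le[of "h j" m] isometric_multiplierD(2)[OF P G(1)[of j]] power_mono[OF K[of j], of 2]
    by (simp add: G(2))
  with G(1) have Gl: "Abs_fps g \<in> hardy_fps"
    by (rule hardy_fps_coefficientwise_limit(1)[of G "Abs_fps g" "K\<^sup>2", rotated]) (simp add: g)
  have "hb_row l m = P * Abs_fps g"
  proof (rule fps_ext)
    fix k
    have "(\<lambda>j. hb_row (h j) m $ k - hb_row l m $ k) \<longlonglongrightarrow> 0"
    proof (rule Lim_null_comparison)
      show "(\<lambda>j. norm (h j - l)) \<longlonglongrightarrow> 0"
        using lim by (simp add: LIM_zero tendsto_norm_zero)
      show "\<forall>\<^sub>F j in sequentially. norm (hb_row (h j) m $ k - hb_row l m $ k) \<le> norm (h j - l)"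
      proof (rule always_eventually, rule allI)
        fix j
        show "norm (hb_row (h j) m $ k - hb_row l m $ k) \<le> norm (h j - l)"
          using nth_le[of "h j - l" k] by (simp add: row_diff)
      qed
    qed
    then have "(\<lambda>j. hb_row (h j) m $ k) \<longlonglongrightarrow> hb_row l m $ k"
      by (rule LIM_zero_cancel)
    moreover have "(\<lambda>j. hb_row (h j) m $ k) \<longlonglongrightarrow> (P * Abs_fps g) $ k"
      unfolding G(2) fps_mult_nth by (intro tendsto_intros) (simp add: g)
    ultimately show "hb_row l m $ k = (P * Abs_fps g) $ k"
      by (rule LIMSEQ_unique)
  qed
  with Gl show "l \<in> {h. \<exists>G\<in>hardy_fps. hb_row h m = P * G}"
    by blast
qed

text \<open>An explicit closed space that contains the Rudin submodule. It is the form in which membership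
  in the submodule is used.\<close>

definition row_multiples :: "(nat \<Rightarrow> complex fps) \<Rightarrow> hardy_bidisc set"
  where "row_multiples \<Phi> = {h. \<forall>m. \<exists>G\<in>hardy_fps. hb_row h m = \<Phi> m * G}"

lemma closed_row_multiples_all:
  assumes "\<And>n. isometric_multiplier (\<Phi> n)"
  shows "closed (row_multiples \<Phi>)"
proof -
  have "row_multiples \<Phi> = (\<Inter>m. {h. \<exists>G\<in>hardy_fps. hb_row h m = \<Phi> m * G})"
    by (auto simp: row_multiples_def)
  then show ?thesis
    using assms by (auto intro!: closed_INT closed_row_multiples)
qed

lemma subspace_row_multiples: "hb.subspace (row_multiples \<Phi>)"
proof (rule hb.subspaceI)
  show "0 \<in> row_multiples \<Phi>"
    by (auto simp: row_multiples_def intro!: bexI[of _ 0] zero_in_hardy_fps)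
  fix f g c assume "f \<in> row_multiples \<Phi>"
  then have f: "\<exists>G\<in>hardy_fps. hb_row f m = \<Phi> m * G" for m
    by (simp add: row_multiples_def)
  show "hb_scale c f \<in> row_multiples \<Phi>"
    unfolding row_multiples_def
  proof (intro CollectI allI)
    fix m
    from f[of m] obtain F where "F \<in> hardy_fps" "hb_row f m = \<Phi> m * F" by blast
    then show "\<exists>G\<in>hardy_fps. hb_row (hb_scale c f) m = \<Phi> m * G"
      by (intro bexI[of _ "fps_const c * F"] hardy_fps_scale) (simp_all add: row_scale mult_ac)
  qed
  assume "g \<in> row_multiples \<Phi>"
  then have g: "\<exists>G\<in>hardy_fps. hb_row g m = \<Phi> m * G" for m
    by (simp add: row_multiples_def)
  show "f + g \<in> row_multiples \<Phi>"
    unfolding row_multiples_def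
  proof (intro CollectI allI)
    fix m
    from f[of m] g[of m] obtain F G where "F \<in> hardy_fps" "hb_row f m = \<Phi> m * F" "G \<in> hardy_fps" "hb_row g m = \<Phi> m * G" by blast
    then show "\<exists>G\<in>hardy_fps. hb_row (f + g) m = \<Phi> m * G"
      by (intro bexI[of _ "F + G"]) (auto simp: row_add distrib_left hardy_fps_add)
  qed
qed

lemma hb_closed_span_superset: "X \<subseteq> hb_closed_span X"
  unfolding hb_closed_span_def using hb.span_superset closure_subset by blast

lemma hb_closed_span_minimal:
  assumes "X \<subseteq> T" "hb.subspace T" "closed T"
  shows "hb_closed_span X \<subseteq> T"
  unfolding hb_closed_span_def
  by (intro closure_minimal hb.span_minimal assms)

text \<open>An abstract Rudin submodule: inner functions, each of which divides its predecessor with an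
  inner quotient. The Blaschke structure enters through these assumptions.\<close>

locale decreasing_inner_functions =
  fixes \<phi> :: "nat \<Rightarrow> complex \<Rightarrow> complex" and \<Phi> B :: "nat \<Rightarrow> complex fps"
  assumes series: "hardy_series (\<phi> n) (\<Phi> n)"
    and isometric: "isometric_multiplier (\<Phi> n)" "isometric_multiplier (B n)"
    and quotient: "\<Phi> n = B n * \<Phi> (Suc n)"
begin

abbreviation \<S> where "\<S> \<equiv> rudin_submodule \<phi>"

lemma quotient_add: "\<exists>P. isometric_multiplier P \<and> \<Phi> n = P * \<Phi> (n + k)"
proof (induction k)
  case 0
  show ?case using isometric_multiplier_one by (intro exI[of _ 1]) simp
next
  case (Suc k)
  then obtain P where "isometric_multiplier P" "\<Phi> n = P * \<Phi> (n + k)" by blast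
  then show ?case
    using isometric(2)[of "n + k"] quotient[of "n + k"]
    by (intro exI[of _ "P * B (n + k)"]) (simp add: isometric_multiplier_mult mult.assoc)
qed

text \<open>The tensor \<open>z\<^sup>n f \<otimes> \<phi>\<^sub>n g\<close> has no rows below \<open>n\<close>, and for \<open>m \<ge> n\<close> its row is a multiple of \<open>\<phi>\<^sub>n\<close>, which \<open>\<phi>\<^sub>m\<close>
  divides.\<close>

lemma tensor_in_row_multiples:
  assumes "h \<in> elementary_tensors (multiples (\<lambda>z. z ^ n)) (multiples (\<phi> n))"
  shows "h \<in> row_multiples \<Phi>"
proof -
  from assms obtain f g where f: "f \<in> hardy_disc" and g: "g \<in> hardy_disc"
    and h: "\<And>z w. z \<in> unit_disc \<Longrightarrow> w \<in> unit_disc \<Longrightarrow> hb_fun h (z, w) = (z ^ n * f z) * (\<phi> n w * g w)"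
    by (auto simp: elementary_tensors_def multiples_def)
  obtain F where F: "hardy_series f F" using f by (auto simp: hardy_disc_iff)
  obtain G where G: "hardy_series g G" using g by (auto simp: hardy_disc_iff)
  have rows: "hb_row h m = fps_const ((fps_X ^ n * F) $ m) * (\<Phi> n * G)" for m
    by (rule row_tensor[OF _ _ h])
      (intro hardy_series_mult hardy_series_X_power series F G isometric
        isometric_multiplier_power isometric_multiplier_X)+
  have G': "G \<in> hardy_fps" using G by (simp add: hardy_series_def)
  show ?thesis
    unfolding row_multiples_def
  proof (intro CollectI allI)
    fix m
    show "\<exists>G\<in>hardy_fps. hb_row h m = \<Phi> m * G"
    proof (cases "m < n")
      case True
      then have "hb_row h m = 0"
        by (simp add: rows fps_X_power_mult_nth)
      then show ?thesis by (intro bexI[of _ 0] zero_in_hardy_fps) simp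
    next
      case False
      then obtain P where P: "isometric_multiplier P" "\<Phi> n = P * \<Phi> m"
        using quotient_add[of n "m - n"] by auto
      show ?thesis
      proof
        show "fps_const ((fps_X ^ n * F) $ m) * (P * G) \<in> hardy_fps"
          by (intro hardy_fps_scale isometric_multiplierD P G')
        show "hb_row h m = \<Phi> m * (fps_const ((fps_X ^ n * F) $ m) * (P * G))"
          unfolding rows P(2) by (simp only: mult_ac)
      qed
    qed
  qed
qed

lemma rudin_submodule_subset_row_multiples: "\<S> \<subseteq> row_multiples \<Phi>"
  unfolding rudin_submodule_def hilbert_tensor_def
  by (intro hb_closed_span_minimal UN_least subspace_row_multiples closed_row_multiples_all
      isometric subsetI tensor_in_row_multiples)

lemma single_row_in_generators:
  assumes A: "A \<in> hardy_fps"
  shows "single_row n (\<Phi> n * A) \<in> (\<Union>n. hilbert_tensor (multiples (\<lambda>z. z ^ n)) (multiples (\<phi> n)))"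
proof -
  define f g where "f = (\<lambda>z::complex. z ^ n * eval_fps 1 z)" and "g = (\<lambda>z. \<phi> n z * eval_fps A z)"
  have f: "hardy_series f (fps_X ^ n * 1)" and g: "hardy_series g (\<Phi> n * A)"
    unfolding f_def g_def
    by (intro hardy_series_mult hardy_series_X_power series isometric hardy_series_exists A
        isometric_multiplier_power isometric_multiplier_X one_in_hardy_fps)+
  have "f \<in> multiples (\<lambda>z. z ^ n)" "g \<in> multiples (\<phi> n)"
    unfolding f_def g_def multiples_def using hardy_series_exists[OF A] hardy_series_exists[OF one_in_hardy_fps]
    by (blast intro: hardy_disc_iff[THEN iffD2] imageI)+
  moreover have "\<exists>h. \<forall>z\<in>unit_disc. \<forall>w\<in>unit_disc. hb_fun h (z, w) = f z * g w"
    using elementary_tensor_exists[of f g] f g unfolding hardy_disc_iff by blast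
  then obtain h where h: "\<And>z w. z \<in> unit_disc \<Longrightarrow> w \<in> unit_disc \<Longrightarrow> hb_fun h (z, w) = f z * g w"
    by blast
  ultimately have "h \<in> elementary_tensors (multiples (\<lambda>z. z ^ n)) (multiples (\<phi> n))"
    unfolding elementary_tensors_def by blast
  then have "h \<in> hilbert_tensor (multiples (\<lambda>z. z ^ n)) (multiples (\<phi> n))"
    unfolding hilbert_tensor_def using hb_closed_span_superset by blast
  moreover have "h = single_row n (\<Phi> n * A)"
  proof (rule hb_eqI_rows)
    fix m
    have "\<Phi> n * A \<in> hardy_fps" by (intro isometric_multiplierD isometric A)
    then show "hb_row h m = hb_row (single_row n (\<Phi> n * A)) m"
      by (subst row_tensor[OF f g h]) (simp_all add: row_single_row)
  qed
  ultimately show ?thesis by blast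
qed

lemma single_row_in_submodule: "A \<in> hardy_fps \<Longrightarrow> single_row n (\<Phi> n * A) \<in> \<S>"
  unfolding rudin_submodule_def using single_row_in_generators hb_closed_span_superset by blast

text \<open>Each \<open>z\<^sub>1\<^sup>n \<Phi>\<^sub>n\<close> is itself among the generators, so finite combinations lie in the linear span before
  any closure is taken.\<close>

lemma span_single_rows_subset_submodule: "hb.span ((\<lambda>n. single_row n (\<Phi> n)) ` I) \<subseteq> \<S>"
proof -
  have "(\<lambda>n. single_row n (\<Phi> n)) ` I \<subseteq> (\<Union>n. hilbert_tensor (multiples (\<lambda>z. z ^ n)) (multiples (\<phi> n)))"
    using single_row_in_generators[OF one_in_hardy_fps] by auto
  from hb.span_mono[OF this] show ?thesis
    unfolding rudin_submodule_def hb_closed_span_def using closure_subset by blast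
qed

lemma zero_in_submodule: "0 \<in> \<S>"
  using span_single_rows_subset_submodule[of "{}"] by simp

lemma row_single_row_\<Phi>: "hb_row (single_row n (\<Phi> n)) m = (if m = n then \<Phi> n else 0)"
  by (simp add: row_single_row isometric isometric_multiplier_in_hardy_fps)

text \<open>The powers of \<open>z\<^sub>1\<close> that occur in the basis of the wandering subspace.\<close>

abbreviation wandering_indices :: "nat set"
  where "wandering_indices \<equiv> insert 0 (Suc ` {n. B n $ 0 = 0})"

text \<open>Row \<open>n\<close> of any element of \<open>z_range \<S>\<close> has the form \<open>\<Phi>\<^sub>n H\<close> with \<open>H(0) = 0\<close>: the part from \<open>z\<^sub>2\<close>
  has a factor \<open>z\<close>, and the part from \<open>z\<^sub>1\<close> is zero for \<open>n = 0\<close> and has the factor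
  \<open>\<Phi>\<^sub>k = \<Phi>\<^sub>n B\<^sub>k\<close> with \<open>B\<^sub>k(0) = 0\<close> for \<open>n = k + 1\<close>. Hence its inner product with \<open>\<Phi>\<^sub>n\<close> is \<open>H(0) = 0\<close>.\<close>

lemma single_row_orthogonal:
  assumes n: "n \<in> wandering_indices" and g: "g \<in> z_range \<S>"
  shows "hb_cinner (single_row n (\<Phi> n)) g = 0"
proof -
  obtain f g' where "f \<in> \<S>" "g' \<in> \<S>" and g: "g = mult_z1 f + mult_z2 g'"
    using g by (auto simp: z_range_def)
  then have rows: "f \<in> row_multiples \<Phi>" "g' \<in> row_multiples \<Phi>"
    using rudin_submodule_subset_row_multiples by auto
  then obtain G where G: "G \<in> hardy_fps" "hb_row g' n = \<Phi> n * G"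
    unfolding row_multiples_def by blast
  obtain Q where Q: "Q \<in> hardy_fps" "Q $ 0 = 0" "hb_row (mult_z1 f) n = \<Phi> n * Q"
  proof (cases n)
    case 0
    then show thesis
      using that[of 0] zero_in_hardy_fps by (simp add: row_mult_z1)
  next
    case (Suc k)
    obtain F where F: "F \<in> hardy_fps" "hb_row f k = \<Phi> k * F"
      using rows unfolding row_multiples_def by blast
    have "hb_row (mult_z1 f) n = \<Phi> n * (B k * F)"
      unfolding Suc row_mult_z1 nat.case F(2) by (subst quotient) (simp only: mult_ac)
    moreover have "B k $ 0 = 0" using n Suc by auto
    ultimately show thesis
      using that[of "B k * F"] isometric_multiplierD(1)[OF isometric(2) F(1)] by simp
  qed
  define H where "H = Q + fps_X * G"
  have H: "H \<in> hardy_fps" "H $ 0 = 0"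
    unfolding H_def using Q G by (auto intro!: hardy_fps_add isometric_multiplierD isometric_multiplier_X)
  have gH: "hb_row g n = \<Phi> n * H"
    by (simp add: g row_add row_mult_z2 Q G H_def algebra_simps)
  have "hb_cinner g (single_row n (\<Phi> n)) = fps_cinner (hb_row g n) (hb_row (single_row n (\<Phi> n)) n)"
    by (rule hb_cinner_single_row) (simp add: row_single_row_\<Phi>)
  also have "\<dots> = fps_cinner (\<Phi> n * H) (\<Phi> n * 1)"
    by (simp add: row_single_row_\<Phi> gH)
  also have "\<dots> = fps_cinner H (fps_X ^ 0)"
    by (simp only: isometric_multiplier_cinner[OF isometric(1) H(1) one_in_hardy_fps] power_0)
  also have "\<dots> = 0"
    by (simp only: fps_cinner_X_power H)
  finally show ?thesis
    by (subst hb_cinner_commute) simp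
qed

text \<open>Let the row be \<open>\<Phi>\<^sub>m G\<close>. Testing against \<open>z\<^sub>2\<close> times \<open>z\<^sub>1\<^sup>m \<Phi>\<^sub>m z\<^sub>2\<^sup>j\<close> kills the coefficient
  \<open>j + 1\<close> of \<open>G\<close>, so \<open>G\<close> is a constant \<open>c\<close>. For \<open>m = k + 1\<close>, testing against \<open>z\<^sub>1\<close> times
  \<open>z\<^sub>1\<^sup>k \<Phi>\<^sub>k\<close>, whose only row is \<open>\<Phi>\<^sub>m B\<^sub>k\<close>, gives \<open>c\<close> times the conjugate of \<open>B\<^sub>k(0)\<close>.\<close>

lemma rows_of_wandering_vector:
  assumes f: "f \<in> \<S> \<ominus>\<^sub>H z_range \<S>"
  shows "\<exists>c. hb_row f m = fps_const c * \<Phi> m \<and> (m \<notin> wandering_indices \<longrightarrow> c = 0)"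
proof -
  have orth: "hb_cinner f (mult_z1 g) = 0" "hb_cinner f (mult_z2 g) = 0" if "g \<in> \<S>" for g
  proof -
    have "mult_z1 0 = 0" "mult_z2 0 = 0"
      by (auto intro!: hb_eqI_rows simp: row_mult_z1 row_mult_z2 split: nat.split)
    then have "mult_z1 g \<in> z_range \<S>" "mult_z2 g \<in> z_range \<S>"
      using that zero_in_submodule unfolding z_range_def
      by (metis (mono_tags, lifting) add.right_neutral mem_Collect_eq,
          metis (mono_tags, lifting) add.left_neutral mem_Collect_eq)
    then show "hb_cinner f (mult_z1 g) = 0" "hb_cinner f (mult_z2 g) = 0"
      using f by (auto simp: hb_ominus_def)
  qed
  have "f \<in> row_multiples \<Phi>"
    using f rudin_submodule_subset_row_multiples by (auto simp: hb_ominus_def)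
  then obtain G where G: "G \<in> hardy_fps" "hb_row f m = \<Phi> m * G"
    unfolding row_multiples_def by blast
  have "G $ Suc j = 0" for j
  proof -
    let ?A = "fps_X ^ j :: complex fps"
    have A: "\<Phi> m * ?A \<in> hardy_fps"
      by (intro isometric_multiplierD isometric fps_X_power_in_hardy_fps)
    have "G $ Suc j = fps_cinner (\<Phi> m * G) (\<Phi> m * fps_X ^ Suc j)"
      by (simp only: isometric_multiplier_cinner[OF isometric(1) G(1) fps_X_power_in_hardy_fps] fps_cinner_X_power)
    also have "\<dots> = hb_cinner f (mult_z2 (single_row m (\<Phi> m * ?A)))"
      by (subst hb_cinner_single_row[of m]) (simp_all add: row_mult_z2 row_single_row[OF A] G(2) mult_ac)
    also have "\<dots> = 0"
      by (intro orth single_row_in_submodule fps_X_power_in_hardy_fps)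
    finally show ?thesis .
  qed
  then have G0: "G = fps_const (G $ 0)"
    unfolding fps_eq_iff fps_nth_fps_const by (metis not0_implies_Suc)
  moreover have "G $ 0 = 0" if m': "m \<notin> wandering_indices"
  proof -
    obtain k where m: "m = Suc k" and k: "B k $ 0 \<noteq> 0"
      using m' by (cases m) auto
    have Bk: "B k \<in> hardy_fps" by (intro isometric_multiplier_in_hardy_fps isometric)
    have "0 = hb_cinner f (mult_z1 (single_row k (\<Phi> k * 1)))"
      using orth(1)[OF single_row_in_submodule[OF one_in_hardy_fps]] by simp
    also have "\<dots> = fps_cinner (hb_row f m) (\<Phi> k)"
      by (subst hb_cinner_single_row[of m])
        (auto simp: row_mult_z1 row_single_row_\<Phi> m split: nat.split)
    also have "\<dots> = fps_cinner (\<Phi> m * G) (\<Phi> m * B k)"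
      unfolding G(2) by (subst quotient[of k]) (simp only: m mult.commute)
    also have "\<dots> = fps_cinner G (B k)"
      by (rule isometric_multiplier_cinner[OF isometric(1) G(1) Bk])
    also have "\<dots> = G $ 0 * cnj (B k $ 0)"
      by (subst G0) (rule fps_cinner_const_left)
    finally show ?thesis using k by simp
  qed
  ultimately show ?thesis
    using G(2) by (intro exI[of _ "G $ 0"]) (metis mult.commute)
qed

lemma wandering_subspace_eq_span:
  assumes fin: "finite {n. B n $ 0 = 0}"
  shows "\<S> \<ominus>\<^sub>H z_range \<S> = hb.span ((\<lambda>n. single_row n (\<Phi> n)) ` wandering_indices)"
proof
  show "\<S> \<ominus>\<^sub>H z_range \<S> \<subseteq> hb.span ((\<lambda>n. single_row n (\<Phi> n)) ` wandering_indices)"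
  proof
    fix f assume "f \<in> \<S> \<ominus>\<^sub>H z_range \<S>"
    then have "\<forall>m. \<exists>c. hb_row f m = fps_const c * \<Phi> m \<and> (m \<notin> wandering_indices \<longrightarrow> c = 0)"
      using rows_of_wandering_vector by blast
    then obtain c where c: "\<And>m. hb_row f m = fps_const (c m) * \<Phi> m" "\<And>m. m \<notin> wandering_indices \<Longrightarrow> c m = 0"
      by metis
    have "f = (\<Sum>n\<in>wandering_indices. hb_scale (c n) (single_row n (\<Phi> n)))"
    proof (rule hb_eqI_rows)
      fix m
      have "hb_row (\<Sum>n\<in>wandering_indices. hb_scale (c n) (single_row n (\<Phi> n))) m
          = (\<Sum>n\<in>wandering_indices. if m = n then fps_const (c n) * \<Phi> n else 0)"
        unfolding row_sum row_scale row_single_row_\<Phi> by (intro sum.cong) auto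
      also have "\<dots> = (if m \<in> wandering_indices then fps_const (c m) * \<Phi> m else 0)"
        using fin by (subst sum.delta') auto
      also have "\<dots> = hb_row f m"
        using c by auto
      finally show "hb_row f m = hb_row (\<Sum>n\<in>wandering_indices. hb_scale (c n) (single_row n (\<Phi> n))) m" ..
    qed
    then show "f \<in> hb.span ((\<lambda>n. single_row n (\<Phi> n)) ` wandering_indices)"
      by (simp only:) (intro hb.span_sum hb.span_scale hb.span_base imageI)
  qed
next
  have "hb.subspace {f. \<forall>g\<in>z_range \<S>. hb_cinner f g = 0}"
    by (rule hb.subspaceI)
      (auto simp: hb_cinner_add_left hb_cinner_scale_left hb_cinner_zero_left)
  then have "hb.span ((\<lambda>n. single_row n (\<Phi> n)) ` wandering_indices) \<subseteq> {f. \<forall>g\<in>z_range \<S>. hb_cinner f g = 0}"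
    using single_row_orthogonal by (intro hb.span_minimal) auto
  with span_single_rows_subset_submodule
  show "hb.span ((\<lambda>n. single_row n (\<Phi> n)) ` wandering_indices) \<subseteq> \<S> \<ominus>\<^sub>H z_range \<S>"
    unfolding hb_ominus_def by blast
qed

lemma inj_single_row: "inj (\<lambda>n. single_row n (\<Phi> n))"
proof (rule injI)
  fix m n assume "single_row m (\<Phi> m) = single_row n (\<Phi> n)"
  then have "hb_row (single_row m (\<Phi> m)) m = hb_row (single_row n (\<Phi> n)) m"
    by simp
  then show "m = n"
    using isometric_multiplier_nonzero[OF isometric(1)] by (auto simp: row_single_row_\<Phi> split: if_splits)
qed

lemma independent_single_rows:
  assumes "finite I"
  shows "hb.independent ((\<lambda>n. single_row n (\<Phi> n)) ` I)"
proof (rule hb.independent_if_scalars_zero)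
  fix c x assume sum: "(\<Sum>x\<in>(\<lambda>n. single_row n (\<Phi> n)) ` I. hb_scale (c x) x) = 0"
    and "x \<in> (\<lambda>n. single_row n (\<Phi> n)) ` I"
  then obtain m where m: "m \<in> I" "x = single_row m (\<Phi> m)" by blast
  have "0 = hb_row (\<Sum>n\<in>I. hb_scale (c (single_row n (\<Phi> n))) (single_row n (\<Phi> n))) m"
    using sum by (simp add: sum.reindex[OF inj_on_subset[OF inj_single_row]] o_def)
  also have "\<dots> = (\<Sum>n\<in>I. if m = n then fps_const (c (single_row n (\<Phi> n))) * \<Phi> n else 0)"
    unfolding row_sum row_scale row_single_row_\<Phi> by (intro sum.cong) auto
  also have "\<dots> = fps_const (c x) * \<Phi> m"
    using assms m by (subst sum.delta') auto
  finally show "c x = 0"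
    using isometric_multiplier_nonzero[OF isometric(1)[of m]] by simp
qed (use assms in simp)

text \<open>The functions \<open>z\<^sub>1\<^sup>m \<Phi>\<^sub>m(z\<^sub>2)\<close> with \<open>m\<close> in \<open>wandering_indices\<close> span by \<open>wandering_subspace_eq_span\<close>, and they are
  independent because they are nonzero and of different degrees in \<open>z\<^sub>1\<close>.\<close>

theorem dim_wandering_subspace:
  assumes fin: "finite {n. B n $ 0 = 0}"
  shows "\<exists>E. finite E \<and> hb.span E = \<S> \<ominus>\<^sub>H z_range \<S>"
    and "hb.dim (\<S> \<ominus>\<^sub>H z_range \<S>) = 1 + card {n. B n $ 0 = 0}"
proof -
  let ?E = "(\<lambda>n. single_row n (\<Phi> n)) ` wandering_indices"
  have I: "finite wandering_indices" using fin by simp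
  have "finite ?E" using I by simp
  then show "\<exists>E. finite E \<and> hb.span E = \<S> \<ominus>\<^sub>H z_range \<S>"
    using wandering_subspace_eq_span[OF fin] by blast
  have "hb.dim (\<S> \<ominus>\<^sub>H z_range \<S>) = card ?E"
    unfolding wandering_subspace_eq_span[OF fin]
    by (rule hb.dim_span_eq_card_independent[OF independent_single_rows[OF I]])
  also have "\<dots> = card wandering_indices"
    by (rule card_image[OF inj_on_subset[OF inj_single_row]]) simp
  also have "\<dots> = 1 + card {n. B n $ 0 = 0}"
    using fin by (simp add: card_image)
  finally show "hb.dim (\<S> \<ominus>\<^sub>H z_range \<S>) = 1 + card {n. B n $ 0 = 0}" .
qed

end

section \<open>Blaschke products\<close>

definition blaschke_fps :: "complex \<Rightarrow> complex fps"
  where "blaschke_fps \<alpha> = (if \<alpha> = 0 then fps_X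
    else fps_const (- cnj \<alpha> / of_real (cmod \<alpha>)) *
      ((fps_X - fps_const \<alpha>) / (1 - fps_const (cnj \<alpha>) * fps_X)))"

lemma isometric_multiplier_blaschke_fps:
  assumes "\<alpha> \<in> unit_disc"
  shows "isometric_multiplier (blaschke_fps \<alpha>)"
proof (cases "\<alpha> = 0")
  case False
  then have "cmod (- cnj \<alpha> / of_real (cmod \<alpha>)) = 1"
    by (simp add: norm_divide)
  from isometric_multiplier_blaschke_factor[OF this] assms False show ?thesis
    by (simp add: blaschke_fps_def)
qed (simp add: blaschke_fps_def isometric_multiplier_X)

lemma blaschke_fps_nth_0_eq_0_iff: "blaschke_fps \<alpha> $ 0 = 0 \<longleftrightarrow> \<alpha> = 0"
  by (simp add: blaschke_fps_def fps_divide_unit)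

lemma blaschke_has_fps_expansion: "blaschke \<alpha> has_fps_expansion blaschke_fps \<alpha>"
proof (cases "\<alpha> = 0")
  case True
  then have "blaschke \<alpha> = (\<lambda>z. z)"
    by (simp add: blaschke_def fun_eq_iff)
  with True show ?thesis by (simp add: blaschke_fps_def has_fps_expansion_fps_X)
next
  case False
  have "(\<lambda>z. - cnj \<alpha> / of_real (cmod \<alpha>) * ((z - \<alpha>) / (1 - cnj \<alpha> * z))) has_fps_expansion
      fps_const (- cnj \<alpha> / of_real (cmod \<alpha>)) *
        ((fps_X - fps_const \<alpha>) / (1 - fps_const (cnj \<alpha>) * fps_X))"
    by (intro fps_expansion_intros has_fps_expansion_divide') auto
  with False show ?thesis
    by (simp add: blaschke_def[abs_def] blaschke_fps_def)
qed

lemma blaschke_denominator: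
  assumes "\<alpha> \<in> unit_disc" "cmod z < 1"
  shows "1 - cmod z \<le> cmod (1 - cnj \<alpha> * z)" "1 - cnj \<alpha> * z \<noteq> 0"
proof -
  have "cmod (cnj \<alpha> * z) \<le> 1 * cmod z"
    using assms by (simp only: norm_mult) (intro mult_right_mono, auto)
  then show *: "1 - cmod z \<le> cmod (1 - cnj \<alpha> * z)"
    using norm_triangle_ineq2[of 1 "cnj \<alpha> * z"] by simp
  then show "1 - cnj \<alpha> * z \<noteq> 0"
    using assms by auto
qed

lemma norm_blaschke_le_1:
  assumes "\<alpha> \<in> unit_disc" "cmod z < 1"
  shows "cmod (blaschke \<alpha> z) \<le> 1"
proof (cases "\<alpha> = 0")
  case False
  then have "cmod (blaschke \<alpha> z) = cmod (Moebius_function 0 \<alpha> z)"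
    by (simp add: blaschke_def Moebius_function_def norm_mult norm_divide)
  also have "\<dots> \<le> 1"
    using Moebius_function_norm_lt_1[of \<alpha> z 0] assms by simp
  finally show ?thesis .
qed (use assms in \<open>simp add: blaschke_def\<close>)

lemma holomorphic_blaschke:
  assumes "\<alpha> \<in> unit_disc"
  shows "blaschke \<alpha> holomorphic_on unit_disc"
proof (cases "\<alpha> = 0")
  case True
  then have "blaschke \<alpha> = (\<lambda>z. z)"
    by (simp add: blaschke_def fun_eq_iff)
  then show ?thesis by simp
next
  case False
  have "(\<lambda>z. - cnj \<alpha> / of_real (cmod \<alpha>) * ((z - \<alpha>) / (1 - cnj \<alpha> * z))) holomorphic_on unit_disc"
    by (intro holomorphic_intros) (use blaschke_denominator(2)[OF assms] in auto)
  with False show ?thesis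
    by (simp add: blaschke_def[abs_def])
qed

text \<open>For \<open>\<alpha> \<noteq> 0\<close> and \<open>r = \<bar>\<alpha>\<bar>\<close>, clearing denominators gives
  \<open>b - 1 = - (1 - r) (cnj \<alpha> z + r) / (r (1 - cnj \<alpha> z))\<close>, in which the factor \<open>r\<close> of the denominator cancels against
  \<open>\<bar>cnj \<alpha> z + r\<bar> \<le> r (1 + \<bar>z\<bar>)\<close>. So the bound is uniform as \<open>\<alpha>\<close> approaches 0.\<close>

lemma norm_blaschke_minus_1_le:
  assumes \<alpha>: "\<alpha> \<in> unit_disc" and z: "cmod z \<le> \<rho>" and \<rho>: "\<rho> < 1"
  shows "cmod (blaschke \<alpha> z - 1) \<le> (1 - cmod \<alpha>) * ((1 + \<rho>) / (1 - \<rho>))"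
proof (cases "\<alpha> = 0")
  case True
  have "cmod (z - 1) \<le> 1 + \<rho>"
    using norm_triangle_ineq4[of z 1] z by simp
  also have "\<dots> \<le> (1 + \<rho>) / (1 - \<rho>)"
  proof -
    have "0 \<le> \<rho>" using z norm_ge_zero order_trans by blast
    then show ?thesis using \<rho> by (simp add: pos_le_divide_eq algebra_simps)
  qed
  finally show ?thesis
    using True by (simp add: blaschke_def)
next
  case False
  define r D where "r = cmod \<alpha>" and "D = 1 - cnj \<alpha> * z"
  have r: "0 < r" "r < 1"
    using False \<alpha> by (auto simp: r_def)
  have rr: "\<alpha> * cnj \<alpha> = of_real r * of_real r"
    by (metis complex_norm_square mult.commute of_real_mult power2_eq_square r_def)
  have "cmod (1 - of_real r) = \<bar>1 - r\<bar>"
    by (metis norm_of_real of_real_1 of_real_diff)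
  then have r1: "cmod (1 - of_real r) = 1 - r"
    using r by simp
  have D: "D \<noteq> 0" "1 - \<rho> \<le> cmod D"
    using blaschke_denominator[OF \<alpha>, of z] z \<rho> by (auto simp: D_def)
  have "blaschke \<alpha> z = - cnj \<alpha> * (z - \<alpha>) / (of_real r * D)"
    using False by (simp add: blaschke_def r_def D_def)
  then have "blaschke \<alpha> z - 1 = (- cnj \<alpha> * (z - \<alpha>) - of_real r * D) / (of_real r * D)"
    using r D by (simp add: diff_divide_distrib)
  also have "- cnj \<alpha> * (z - \<alpha>) - of_real r * D = - ((1 - of_real r) * (cnj \<alpha> * z + of_real r))"
    unfolding D_def by (simp add: algebra_simps rr)
  finally have "cmod (blaschke \<alpha> z - 1) = (1 - r) * cmod (cnj \<alpha> * z + of_real r) / (r * cmod D)"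
    using r r1 by (simp add: norm_divide norm_mult del: of_real_1)
  also have "\<dots> \<le> (1 - r) * (r * (1 + \<rho>)) / (r * (1 - \<rho>))"
  proof (rule frac_le)
    have "cmod (cnj \<alpha> * z + of_real r) \<le> r * cmod z + r"
      using norm_triangle_ineq[of "cnj \<alpha> * z" "of_real r"] r by (simp add: norm_mult r_def)
    also have "\<dots> \<le> r * (1 + \<rho>)"
      using r z by (simp add: algebra_simps)
    finally show "(1 - r) * cmod (cnj \<alpha> * z + of_real r) \<le> (1 - r) * (r * (1 + \<rho>))"
      using r by (intro mult_left_mono) auto
    show "0 \<le> (1 - r) * (r * (1 + \<rho>))"
      using r z norm_ge_zero[of z] by (intro mult_nonneg_nonneg) linarith+
    show "0 < r * (1 - \<rho>)" using r \<rho> by simp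
    show "r * (1 - \<rho>) \<le> r * cmod D" using r D by simp
  qed
  also have "\<dots> = (1 - r) * ((1 + \<rho>) / (1 - \<rho>))"
    using r by simp
  finally show ?thesis by (simp add: r_def)
qed

lemma uniform_limit_boundI:
  assumes "\<And>n z. z \<in> X \<Longrightarrow> dist (f n z) (g z) \<le> e n" "e \<longlonglongrightarrow> (0::real)"
  shows "uniform_limit X f g sequentially"
  unfolding uniform_limit_iff
proof (intro allI impI)
  fix \<epsilon> :: real assume "\<epsilon> > 0"
  from order_tendstoD(2)[OF assms(2) this]
  show "\<forall>\<^sub>F n in sequentially. \<forall>z\<in>X. dist (f n z) (g z) < \<epsilon>"
    by eventually_elim (use assms(1) in \<open>blast intro: le_less_trans\<close>)
qed

locale blaschke_sequence =
  fixes \<alpha> :: "nat \<Rightarrow> complex" and l :: "nat \<Rightarrow> nat"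
  assumes in_disc: "\<alpha> n \<in> unit_disc"
    and summable: "summable (\<lambda>n. real (l n) * (1 - cmod (\<alpha> n)))"
begin

text \<open>The tail of the Blaschke sum, which controls the distance of the tail product from 1.\<close>

definition mass :: "nat \<Rightarrow> real"
  where "mass n = (\<Sum>i. real (l (n + i)) * (1 - cmod (\<alpha> (n + i))))"

lemma summable_tail: "summable (\<lambda>i. real (l (n + i)) * (1 - cmod (\<alpha> (n + i))))"
  using summable_ignore_initial_segment[OF summable, of n] by (simp add: add.commute)

lemma mass_tendsto_0: "mass \<longlonglongrightarrow> 0"
  using suminf_exist_split2[OF summable] by (simp add: mass_def[abs_def] add.commute)

lemma term_nonneg: "0 \<le> real (l n) * (1 - cmod (\<alpha> n))"
  using in_disc[of n] by simp

lemma norm_factor_minus_1_le: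
  assumes "cmod z \<le> \<rho>" "\<rho> < 1"
  shows "cmod (blaschke (\<alpha> i) z ^ l i - 1) \<le> (1 + \<rho>) / (1 - \<rho>) * (real (l i) * (1 - cmod (\<alpha> i)))"
proof -
  have "cmod (blaschke (\<alpha> i) z ^ l i - 1 ^ l i) \<le> real (l i) * cmod (blaschke (\<alpha> i) z - 1)"
    using assms by (intro norm_power_diff norm_blaschke_le_1[OF in_disc]) auto
  also have "\<dots> \<le> real (l i) * ((1 - cmod (\<alpha> i)) * ((1 + \<rho>) / (1 - \<rho>)))"
    by (intro mult_left_mono norm_blaschke_minus_1_le in_disc assms) auto
  finally show ?thesis by (simp add: mult_ac)
qed

lemma partial_products_tendsto:
  assumes z: "cmod z < 1"
  shows "(\<lambda>M. \<Prod>i<M. blaschke (\<alpha> (n + i)) z ^ l (n + i)) \<longlonglongrightarrow> blaschke_tail \<alpha> l n z"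
proof -
  have "summable (\<lambda>i. cmod (blaschke (\<alpha> (n + i)) z ^ l (n + i) - 1))"
    by (rule summable_comparison_test'[OF summable_mult[OF summable_tail[of n], of "(1 + cmod z) / (1 - cmod z)"], where N = 0])
      (use norm_factor_minus_1_le[OF order_refl z] in simp)
  then have "convergent_prod (\<lambda>i. blaschke (\<alpha> (n + i)) z ^ l (n + i))"
    by (intro abs_convergent_prod_imp_convergent_prod) (simp add: abs_convergent_prod_conv_summable)
  from convergent_prod_LIMSEQ[OF this]
  have "(\<lambda>M. \<Prod>i<Suc M. blaschke (\<alpha> (n + i)) z ^ l (n + i)) \<longlonglongrightarrow> blaschke_tail \<alpha> l n z"
    by (simp only: blaschke_tail_def lessThan_Suc_atMost)
  then show ?thesis by (rule LIMSEQ_imp_Suc)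
qed

text \<open>The standard product estimate \<open>\<bar>\<Prod>(1 + a\<^sub>i) - 1\<bar> \<le> exp (\<Sum>\<bar>a\<^sub>i\<bar>) - 1\<close>, passed to the limit. It supplies both the convergence of the
  tails to 1 and the uniform convergence of the partial products.\<close>

lemma norm_blaschke_tail_minus_1_le:
  assumes z: "cmod z \<le> \<rho>" and \<rho>: "\<rho> < 1"
  shows "cmod (blaschke_tail \<alpha> l n z - 1) \<le> exp ((1 + \<rho>) / (1 - \<rho>) * mass n) - 1"
proof (rule LIMSEQ_le_const2)
  show "(\<lambda>M. cmod ((\<Prod>i<M. blaschke (\<alpha> (n + i)) z ^ l (n + i)) - 1)) \<longlonglongrightarrow> cmod (blaschke_tail \<alpha> l n z - 1)"
    using z \<rho> by (intro tendsto_intros partial_products_tendsto) simp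
  have "cmod ((\<Prod>i<M. blaschke (\<alpha> (n + i)) z ^ l (n + i)) - 1) \<le> exp ((1 + \<rho>) / (1 - \<rho>) * mass n) - 1" for M
  proof -
    let ?a = "\<lambda>i. blaschke (\<alpha> (n + i)) z ^ l (n + i) - 1"
    have \<rho>0: "0 \<le> (1 + \<rho>) / (1 - \<rho>)"
      using z \<rho> norm_ge_zero[of z] by (intro divide_nonneg_pos) linarith+
    have "cmod ((\<Prod>i<M. 1 + ?a i) - 1) \<le> (\<Prod>i<M. 1 + cmod (?a i)) - 1"
      by (rule norm_prod_minus1_le_prod_minus1)
    also have "(\<Prod>i<M. 1 + cmod (?a i)) \<le> exp (\<Sum>i<M. cmod (?a i))"
      by (rule prod_le_exp_sum) simp
    also have "(\<Sum>i<M. cmod (?a i))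
        \<le> (\<Sum>i<M. (1 + \<rho>) / (1 - \<rho>) * (real (l (n + i)) * (1 - cmod (\<alpha> (n + i)))))"
      by (intro sum_mono norm_factor_minus_1_le z \<rho>)
    also have "\<dots> = (1 + \<rho>) / (1 - \<rho>) * (\<Sum>i<M. real (l (n + i)) * (1 - cmod (\<alpha> (n + i))))"
      by (rule sum_distrib_left[symmetric])
    also have "\<dots> \<le> (1 + \<rho>) / (1 - \<rho>) * mass n"
      unfolding mass_def by (intro mult_left_mono sum_le_suminf summable_tail \<rho>0) (use term_nonneg in auto)
    finally show ?thesis by simp
  qed
  then show "\<exists>N. \<forall>M\<ge>N. cmod ((\<Prod>i<M. blaschke (\<alpha> (n + i)) z ^ l (n + i)) - 1)
      \<le> exp ((1 + \<rho>) / (1 - \<rho>) * mass n) - 1" by blast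
qed

lemma blaschke_tail_bound_tendsto_0: "(\<lambda>n. exp ((1 + \<rho>) / (1 - \<rho>) * mass n) - 1) \<longlonglongrightarrow> 0"
proof -
  have "(\<lambda>n. exp ((1 + \<rho>) / (1 - \<rho>) * mass n) - 1) \<longlonglongrightarrow> exp ((1 + \<rho>) / (1 - \<rho>) * 0) - 1"
    by (intro tendsto_intros mass_tendsto_0)
  then show ?thesis by simp
qed

text \<open>Obtained from the limits of the partial products rather than by dividing infinite products, so
  that it also holds at the zeros of the Blaschke factors.\<close>

lemma blaschke_tail_split:
  assumes z: "cmod z < 1"
  shows "blaschke_tail \<alpha> l n z = (\<Prod>i<M. blaschke (\<alpha> (n + i)) z ^ l (n + i)) * blaschke_tail \<alpha> l (n + M) z"
proof (rule LIMSEQ_unique)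
  have "(\<Prod>i<K + M. blaschke (\<alpha> (n + i)) z ^ l (n + i))
      = (\<Prod>i<M. blaschke (\<alpha> (n + i)) z ^ l (n + i)) * (\<Prod>i<K. blaschke (\<alpha> (n + M + i)) z ^ l (n + M + i))" for K
    by (induction K) (simp_all add: add_ac mult_ac)
  moreover have "(\<lambda>K. (\<Prod>i<M. blaschke (\<alpha> (n + i)) z ^ l (n + i)) * (\<Prod>i<K. blaschke (\<alpha> (n + M + i)) z ^ l (n + M + i)))
      \<longlonglongrightarrow> (\<Prod>i<M. blaschke (\<alpha> (n + i)) z ^ l (n + i)) * blaschke_tail \<alpha> l (n + M) z"
    by (intro tendsto_intros partial_products_tendsto z)
  ultimately show "(\<lambda>K. \<Prod>i<K + M. blaschke (\<alpha> (n + i)) z ^ l (n + i))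
      \<longlonglongrightarrow> (\<Prod>i<M. blaschke (\<alpha> (n + i)) z ^ l (n + i)) * blaschke_tail \<alpha> l (n + M) z"
    by simp
  show "(\<lambda>K. \<Prod>i<K + M. blaschke (\<alpha> (n + i)) z ^ l (n + i)) \<longlonglongrightarrow> blaschke_tail \<alpha> l n z"
    by (rule LIMSEQ_ignore_initial_segment[OF partial_products_tendsto[OF z]])
qed

text \<open>On a smaller disc the partial products converge uniformly: the \<open>M\<close>-th one is bounded by 1,
  and the limit is its product with \<open>blaschke_tail \<alpha> l (n + M)\<close>, which tends uniformly to 1.\<close>

lemma holomorphic_blaschke_tail: "blaschke_tail \<alpha> l n holomorphic_on unit_disc"
proof (rule holomorphic_uniform_sequence[OF open_ball])
  show "(\<lambda>z. \<Prod>i<M. blaschke (\<alpha> (n + i)) z ^ l (n + i)) holomorphic_on unit_disc" for M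
    by (intro holomorphic_intros holomorphic_blaschke in_disc)
  fix x :: complex assume x: "x \<in> unit_disc"
  \<comment> \<open>The closed disc of radius \<open>d\<close> around \<open>x\<close> lies in the closed disc of radius \<open>\<rho> < 1\<close> around 0.\<close>
  define d \<rho> where "d = (1 - cmod x) / 2" and "\<rho> = (1 + cmod x) / 2"
  have d: "0 < d" and \<rho>: "\<rho> < 1"
    using x by (auto simp: d_def \<rho>_def)
  have z\<rho>: "cmod z \<le> \<rho>" if "z \<in> cball x d" for z
    using that norm_triangle_ineq[of x "z - x"] by (simp add: dist_norm norm_minus_commute d_def \<rho>_def field_simps)
  have "uniform_limit (cball x d) (\<lambda>M z. \<Prod>i<M. blaschke (\<alpha> (n + i)) z ^ l (n + i)) (blaschke_tail \<alpha> l n) sequentially"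
  proof (rule uniform_limit_boundI)
    fix M z assume "z \<in> cball x d"
    then have z: "cmod z \<le> \<rho>" "cmod z < 1"
      using z\<rho>[of z] \<rho> by auto
    let ?P = "\<Prod>i<M. blaschke (\<alpha> (n + i)) z ^ l (n + i)"
    have "cmod ?P \<le> 1"
      unfolding prod_norm[symmetric] norm_power
      by (intro prod_le_1) (auto intro!: power_le_one norm_blaschke_le_1 in_disc z)
    moreover have "blaschke_tail \<alpha> l n z - ?P = ?P * (blaschke_tail \<alpha> l (n + M) z - 1)"
      by (subst blaschke_tail_split[OF z(2), of n M]) (simp add: algebra_simps)
    ultimately have "dist ?P (blaschke_tail \<alpha> l n z) \<le> 1 * cmod (blaschke_tail \<alpha> l (n + M) z - 1)"
      unfolding dist_commute[of ?P] by (simp only: dist_norm norm_mult) (intro mult_right_mono, auto)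
    also have "\<dots> \<le> exp ((1 + \<rho>) / (1 - \<rho>) * mass (n + M)) - 1"
      using norm_blaschke_tail_minus_1_le[OF z(1) \<rho>] by simp
    finally show "dist ?P (blaschke_tail \<alpha> l n z) \<le> exp ((1 + \<rho>) / (1 - \<rho>) * mass (n + M)) - 1" .
  next
    show "(\<lambda>M. exp ((1 + \<rho>) / (1 - \<rho>) * mass (n + M)) - 1) \<longlonglongrightarrow> 0"
      using LIMSEQ_ignore_initial_segment[OF blaschke_tail_bound_tendsto_0[of \<rho>], of n]
      by (simp add: add.commute)
  qed
  moreover have "cball x d \<subseteq> unit_disc"
    using z\<rho> \<rho> by force
  ultimately show "\<exists>d>0. cball x d \<subseteq> unit_disc \<and>
      uniform_limit (cball x d) (\<lambda>M z. \<Prod>i<M. blaschke (\<alpha> (n + i)) z ^ l (n + i)) (blaschke_tail \<alpha> l n) sequentially"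
    using d by blast
qed

definition tail_fps :: "nat \<Rightarrow> complex fps"
  where "tail_fps n = fps_expansion (blaschke_tail \<alpha> l n) 0"

lemma blaschke_tail_has_fps_expansion: "blaschke_tail \<alpha> l n has_fps_expansion tail_fps n"
  unfolding tail_fps_def
  by (rule has_fps_expansion_fps_expansion[OF open_ball _ holomorphic_blaschke_tail]) simp

text \<open>Uniform convergence of holomorphic functions near 0 implies convergence of their Taylor coefficients.\<close>

lemma tail_fps_nth_tendsto: "(\<lambda>n. tail_fps n $ k) \<longlonglongrightarrow> 1 $ k"
proof -
  have "uniform_limit (ball 0 (1/2)) (blaschke_tail \<alpha> l) (\<lambda>_. 1) sequentially"
    by (rule uniform_limit_boundI[OF _ blaschke_tail_bound_tendsto_0[of "1/2"]])
      (use norm_blaschke_tail_minus_1_le[of _ "1/2"] in \<open>auto simp: dist_norm\<close>)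
  moreover have "\<forall>\<^sub>F n in sequentially. blaschke_tail \<alpha> l n holomorphic_on ball 0 (1/2)"
    by (intro always_eventually allI holomorphic_on_subset[OF holomorphic_blaschke_tail]) auto
  ultimately have "(\<lambda>n. (deriv ^^ k) (blaschke_tail \<alpha> l n) 0) \<longlonglongrightarrow> (deriv ^^ k) (\<lambda>_. 1) 0"
    by (rule higher_deriv_complex_uniform_limit) auto
  then have "(\<lambda>n. (deriv ^^ k) (blaschke_tail \<alpha> l n) 0 / fact k) \<longlonglongrightarrow> (deriv ^^ k) (\<lambda>_. 1) 0 / fact k"
    by (intro tendsto_divide tendsto_const) auto
  then show ?thesis
    unfolding fps_nth_fps_expansion[OF blaschke_tail_has_fps_expansion]
      fps_nth_fps_expansion[OF has_fps_expansion_1] .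
qed

lemma tail_fps_Suc: "tail_fps n = blaschke_fps (\<alpha> n) ^ l n * tail_fps (Suc n)"
proof (rule fps_expansion_unique_complex[OF blaschke_tail_has_fps_expansion])
  have "(\<lambda>z. blaschke (\<alpha> n) z ^ l n * blaschke_tail \<alpha> l (Suc n) z)
      has_fps_expansion blaschke_fps (\<alpha> n) ^ l n * tail_fps (Suc n)"
    by (intro fps_expansion_intros blaschke_has_fps_expansion blaschke_tail_has_fps_expansion)
  moreover
  have "\<forall>\<^sub>F z in nhds 0. z \<in> unit_disc"
    by (intro eventually_nhds_in_open) auto
  then have "\<forall>\<^sub>F z in nhds 0. blaschke (\<alpha> n) z ^ l n * blaschke_tail \<alpha> l (Suc n) z = blaschke_tail \<alpha> l n z"
    by eventually_elim (use blaschke_tail_split[of _ n 1] in simp)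
  note has_fps_expansion_cong[OF this refl]
  ultimately show "blaschke_tail \<alpha> l n has_fps_expansion blaschke_fps (\<alpha> n) ^ l n * tail_fps (Suc n)"
    by blast
qed

lemma isometric_multiplier_tail_fps: "isometric_multiplier (tail_fps n)"
  by (rule isometric_multiplier_infinite_product[where B = "\<lambda>n. blaschke_fps (\<alpha> n) ^ l n"])
    (intro tail_fps_Suc isometric_multiplier_power isometric_multiplier_blaschke_fps in_disc tail_fps_nth_tendsto)+

lemma eval_tail_fps: "z \<in> unit_disc \<Longrightarrow> eval_fps (tail_fps n) z = blaschke_tail \<alpha> l n z"
  using has_fps_expansion_imp_eval_fps_eq[OF blaschke_tail_has_fps_expansion _ holomorphic_blaschke_tail] by simp

lemma finite_zero_points:
  assumes "\<And>n. l n > 0"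
  shows "finite {n. \<alpha> n = 0}"
proof -
  have "\<forall>\<^sub>F n in sequentially. real (l n) * (1 - cmod (\<alpha> n)) < 1"
    using order_tendstoD(2)[OF summable_LIMSEQ_zero[OF summable]] by simp
  then obtain N where N: "\<And>n. n \<ge> N \<Longrightarrow> real (l n) * (1 - cmod (\<alpha> n)) < 1"
    by (auto simp: eventually_sequentially)
  have "{n. \<alpha> n = 0} \<subseteq> {..<N}"
  proof
    fix n assume "n \<in> {n. \<alpha> n = 0}"
    then have "\<not> real (l n) * (1 - cmod (\<alpha> n)) < 1"
      using assms[of n] by simp
    with N[of n] show "n \<in> {..<N}" by force
  qed
  then show ?thesis by (rule finite_subset) simp
qed

end

section \<open>The dimension formula for Blaschke products\<close>

theorem theorem3p1:
  fixes \<alpha> :: "nat \<Rightarrow> complex" and l :: "nat \<Rightarrow> nat"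
  assumes "\<And>n. \<alpha> n \<in> unit_disc"
    and "\<And>n. l n > 0"
    and "summable (\<lambda>n. real (l n) * (1 - cmod (\<alpha> n)))"
  defines "S \<equiv> rudin_submodule (blaschke_tail \<alpha> l)"
  shows "finite {n. \<alpha> n = 0}
    \<and> (\<exists>B. finite B \<and> hb.span B = S \<ominus>\<^sub>H z_range S)
    \<and> hb.dim (S \<ominus>\<^sub>H z_range S) = 1 + card {n. \<alpha> n = 0}"
proof -
  interpret blaschke_sequence \<alpha> l
    using assms(1,3) by unfold_locales
  have series: "hardy_series (blaschke_tail \<alpha> l n) (tail_fps n)" for n
    by (simp add: hardy_series_eval_fps eval_tail_fps
        isometric_multiplier_in_hardy_fps[OF isometric_multiplier_tail_fps])
  interpret inner: decreasing_inner_functions "blaschke_tail \<alpha> l" tail_fps "\<lambda>n. blaschke_fps (\<alpha> n) ^ l n"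
    by unfold_locales
      (intro series isometric_multiplier_tail_fps tail_fps_Suc isometric_multiplier_power
        isometric_multiplier_blaschke_fps in_disc)+
  have zeros: "{n. (blaschke_fps (\<alpha> n) ^ l n) $ 0 = 0} = {n. \<alpha> n = 0}"
    using assms(2) by (auto simp: fps_nth_power_0 blaschke_fps_nth_0_eq_0_iff)
  have "finite {n. \<alpha> n = 0}"
    by (rule finite_zero_points[OF assms(2)])
  then show ?thesis
    using inner.dim_wandering_subspace unfolding zeros S_def by blast
qed

end
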